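(* Let $n\ge2$ be an integer, $\gamma\in(0,\infty)$, and let $\Omega\in L(\log L)(\mathbb{S}^{n-1})$ be nonnegative. Let $\phi:[0,\infty)\to[0,\infty)$ be nonincreasing with $\phi(|\cdot|)\in L^1(\mathbb{R}^n)$, and suppose that, for any $x\in\mathbb{R}^n\setminus\{\mathbf{0}\}$, $$h(x):=\Omega\left(\frac{x}{|x|}\right)\phi(|x|).$$ For $f\in L^1_{\rm loc}(\mathbb{R}^n)$ and $(x,t)\in\mathbb{R}^n\times(0,\infty)$ define $$T_h(f)(x,t):=t^{-(n+\gamma)}\int_{\mathbb{R}^n}f(y)\,h\left(\frac{x-y}{t}\right)dy.$$ Then there exists a positive constant $C$, depending only on $n$, $\gamma$, and $|\Omega|_{L(\log L)(\mathbb{S}^{n-1})}$, such that, for any $f\in L^1(\mathbb{R}^n)$, $$\sup_{\lambda\in(0,\infty)}\lambda\,\nu_\gamma\left(\left\{(x,t)\in\mathbb{R}^n\times(0,\infty):|T_h(f)(x,t)|>\lambda\right\}\right)\le C\,\|\phi(|\cdot|)\|_{L^1(\mathbb{R}^n)}\,\|f\|_{L^1(\mathbb{R}^n)}.$$ Moreover, the same estimate also holds for $n=1$ and $\Omega\equiv1$.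
   Context: $\mathbb{S}^{n-1}$ is the unit sphere of $\mathbb{R}^n$ with surface measure $\sigma$; $\mathbf{0}$ is the origin of $\mathbb{R}^n$. $\Omega\in L(\log L)(\mathbb{S}^{n-1})$ means that $\Omega$ is measurable and $$|\Omega|_{L(\log L)(\mathbb{S}^{n-1})}:=\int_{\mathbb{S}^{n-1}}|\Omega(\xi)|\,[1+\log^+|\Omega(\xi)|]\,d\sigma(\xi)<\infty,\qquad \log^+z:=\max\{0,\log z\}.$$ $\nu_\gamma$ is the measure on $\mathbb{R}^n\times(0,\infty)$ given by $d\nu_\gamma(x,t):=t^{\gamma-1}\,dt\,dx$. When $n=1$ and $\Omega\equiv1$, $h(x)=\phi(|x|)$ on $\mathbb{R}\setminus\{0\}$. *)

theory Defs
  imports "HOL-Analysis.Analysis"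
begin

text \<open>
  Surface measure on the unit sphere of an \<open>n\<close>-dimensional Euclidean space, given by the usual
  cone construction: \<open>\<sigma>(A)\<close> is \<open>n\<close> times the volume of \<open>{x. 0 < |x| < 1, x/|x| \<in> A}\<close>.  This is
  the measure for which \<open>dx = r^(n-1) dr d\<sigma>\<close> in polar coordinates; for \<open>n = 1\<close> it is the counting
  measure on \<open>{-1, 1}\<close>.
\<close>

definition surface_measure :: "'a::euclidean_space measure" where
  "surface_measure =
     scale_measure (of_nat DIM('a))
       (distr (restrict_space lborel (ball 0 1 - {0})) (restrict_space borel (sphere 0 1))
         (\<lambda>x. x /\<^sub>R norm x))"

lemma space_surface_measure [simp]: "space surface_measure = sphere 0 1"
  by (simp add: surface_measure_def space_scale_measure space_restrict_space)

lemma emeasure_surface_measure: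
  fixes A :: "'a::euclidean_space set"
  assumes "A \<in> sets borel" "A \<subseteq> sphere 0 1"
  shows "emeasure surface_measure A =
    of_nat DIM('a) * emeasure lborel {x. 0 < norm x \<and> norm x < 1 \<and> x /\<^sub>R norm x \<in> A}"
proof -
  let ?B = "ball 0 1 - {0 :: 'a}"
  have A: "A \<in> sets (restrict_space borel (sphere 0 1))"
    using assms by (auto simp: sets_restrict_space)
  have "(\<lambda>x::'a. x /\<^sub>R norm x) \<in> restrict_space lborel ?B \<rightarrow>\<^sub>M restrict_space borel (sphere 0 1)"
    by (intro measurable_restrict_space2 measurable_restrict_space1)
       (auto simp: space_restrict_space)
  moreover have "(\<lambda>x::'a. x /\<^sub>R norm x) -` A \<inter> space (restrict_space lborel ?B) =
      {x. 0 < norm x \<and> norm x < 1 \<and> x /\<^sub>R norm x \<in> A}"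
    by (auto simp: space_restrict_space)
  moreover have "{x. 0 < norm x \<and> norm x < 1 \<and> x /\<^sub>R norm x \<in> A} \<subseteq> ?B"
    by auto
  ultimately show ?thesis
    using A by (simp add: surface_measure_def emeasure_distr emeasure_restrict_space)
qed

definition log_plus :: "real \<Rightarrow> real" where
  "log_plus z = max 0 (ln z)"

text \<open>
  Functions on the sphere are functions on the whole space of which only the values on the sphere
  matter.  Measurability is with respect to the completed surface measure.
\<close>

definition LlogL_norm :: "('a::euclidean_space \<Rightarrow> real) \<Rightarrow> ennreal" where
  "LlogL_norm \<Omega> =
     (\<integral>\<^sup>+\<xi>. ennreal (\<bar>\<Omega> \<xi>\<bar> * (1 + log_plus \<bar>\<Omega> \<xi>\<bar>)) \<partial>completion surface_measure)"

definition LlogL :: "('a::euclidean_space \<Rightarrow> real) set" where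
  "LlogL = {\<Omega>. \<Omega> \<in> borel_measurable (completion surface_measure) \<and> LlogL_norm \<Omega> < \<infinity>}"

definition nu :: "real \<Rightarrow> ('a::euclidean_space \<times> real) measure" where
  "nu \<gamma> = density (restrict_space lborel (UNIV \<times> {0<..})) (\<lambda>(x, t). ennreal (t powr (\<gamma> - 1)))"

text \<open>
  The Bochner integral is \<open>0\<close> where the integrand is not integrable; for integrable \<open>f\<close> and \<open>h\<close>
  this happens only for \<open>(x, t)\<close> in a null set.
\<close>

definition T_op ::
  "real \<Rightarrow> ('a::euclidean_space \<Rightarrow> real) \<Rightarrow> ('a \<Rightarrow> complex) \<Rightarrow> 'a \<times> real \<Rightarrow> complex" where
  "T_op \<gamma> h f = (\<lambda>(x, t).
     of_real (t powr (- (real DIM('a) + \<gamma>))) *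
       (\<integral>y. f y * of_real (h ((x - y) /\<^sub>R t)) \<partial>lebesgue))"

end

theory Submission
  imports Defs
begin

text \<open>
  The idea is to follow, for each point \<open>x\<close> and each distance \<open>\<rho>\<close>, the time at which a truncated
  average of \<open>g = |f|\<close> crosses the level under consideration.

  First \<open>\<phi>\<close> is replaced by a decreasing majorant \<open>\<Phi>\<close> for which \<open>r^(n + \<gamma>/2) \<Phi>(r)\<close> is nondecreasing; this
  costs only a factor in the \<open>L^1\<close> norm (\<open>nn_integral_tail_majorant\<close>).  Put
  \<open>\<theta>(x, \<rho>, t) = t^-(n + \<gamma>) \<integral> g(y) \<Phi>(max |x - y| \<rho> / t) dy\<close>.  For fixed \<open>x\<close> and \<open>\<rho>\<close> this decays at least
  like \<open>t^-(\<gamma>/2)\<close>, so it crosses a level \<open>e\<close> at an essentially unique time, and this time decreases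
  as \<open>\<rho>\<close> grows.  Doubling of \<open>\<Phi>\<close> shows that a move of \<open>x\<close> by at most \<open>\<rho>\<close> changes the crossing time by a
  bounded factor only (\<open>potential_shift\<close>).  Hence the crossing times seen from \<open>x\<close> and from \<open>y\<close> at
  distance \<open>\<rho> = |x - y|\<close> are comparable.

  The estimate rests on one computation (\<open>charging\<close>).  Integrate a kernel
  \<open>t^-n H((x - y)/t) g(y)\<close> against \<open>dx dt/t\<close>, over those \<open>(x, t, y)\<close> for which \<open>t\<close> is comparable with the
  crossing time of \<open>y\<close> at distance \<open>|x - y|\<close>.  After the substitution \<open>x = y + t w\<close> the distance is
  \<open>t |w|\<close>.  As \<open>t\<close> grows so does this distance, and the crossing time goes down; therefore the
  admissible \<open>t\<close> fill an interval of bounded logarithmic length, and the result is at most a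
  constant times \<open>\<parallel>g\<parallel> \<parallel>H\<parallel>\<close>.

  Charging is used twice.  It bounds the measure of the exceptional set \<open>{\<theta>(x, 0, t) > e}\<close>
  (\<open>exceptional_set_bound\<close>): at the top of that set, half of \<open>\<theta>(x, 0, t)\<close> comes from points \<open>y\<close> whose
  crossing time is comparable with \<open>t\<close>.  Off the exceptional set the crossing time of \<open>y\<close> is about
  \<open>t / 2^s\<close> for some \<open>s \<ge> 0\<close>.  Let \<open>W(z) = \<Omega>(z/|z|)\<close>.  Where \<open>W \<le> 2^(\<gamma> s/4)\<close>, the level condition gives a pointwise
  bound with the factor \<open>2^-(\<gamma> s/2) 2^(\<gamma> s/4)\<close>, and these sum to a small multiple of \<open>\<lambda>\<close>.  Where
  \<open>W > 2^(\<gamma> s/4)\<close>, Chebyshev's inequality and charging give \<open>\<parallel>W 1{W > 2^(\<gamma> s/4)} \<phi>\<parallel>\<close>.  The number of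
  such \<open>s\<close> is at most a multiple of \<open>1 + log^+ W\<close>, which is where the \<open>L log L\<close> norm enters
  (\<open>weak_type_rough\<close>, \<open>suminf_exceeded_powers_le\<close>).
\<close>

section \<open>Measurability, scaling and series\<close>

lemma borel_measurable_of_bool [measurable (raw)]:
  assumes "Measurable.pred M P"
  shows "(\<lambda>x. of_bool (P x) :: ennreal) \<in> borel_measurable M"
  unfolding of_bool_def using assms by measurable

lemma borel_measurable_antimono_ennreal:
  fixes f :: "real \<Rightarrow> ennreal"
  assumes "antimono f"
  shows "f \<in> borel_measurable borel"
proof (rule borel_measurableI_greater)
  fix a
  have "is_interval {x. a < f x}"
    unfolding is_interval_1 using assms[THEN antimonoD] by (auto intro: less_le_trans)
  then show "{x \<in> space borel. a < f x} \<in> sets borel"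
    using real_interval_borel_measurable by simp
qed

lemma nn_integral_affine:
  fixes f :: "'a::euclidean_space \<Rightarrow> ennreal"
  assumes [measurable]: "f \<in> borel_measurable borel" and c: "c \<noteq> 0"
  shows "(\<integral>\<^sup>+x. f x \<partial>lborel) = ennreal (\<bar>c\<bar> ^ DIM('a)) * (\<integral>\<^sup>+w. f (a + c *\<^sub>R w) \<partial>lborel)"
  by (subst lborel_affine[OF c, of a])
     (simp add: nn_integral_density nn_integral_distr nn_integral_cmult)

lemma suminf_ennreal_geometric:
  assumes "0 \<le> q" "q < (1::real)"
  shows "(\<Sum>i. ennreal (q ^ i)) = ennreal (1 / (1 - q))"
  using assms by (intro suminf_ennreal_eq geometric_sums) auto

lemma two_power_powr: "(2 ^ i) powr s = (2 powr s) ^ i" for s :: real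
  by (induction i) (simp_all add: powr_mult)

section \<open>Integration over the half space\<close>

text \<open>
  The integral of a nonnegative function against \<open>\<nu>\<^sub>\<gamma>\<close> as an iterated integral, the form to which
  Tonelli's theorem and the change of variables \<open>x = y + t w\<close> apply directly.
\<close>
definition halfspace_integral :: "real \<Rightarrow> ('a::euclidean_space \<Rightarrow> real \<Rightarrow> ennreal) \<Rightarrow> ennreal" where
  "halfspace_integral \<gamma> F =
     (\<integral>\<^sup>+x. \<integral>\<^sup>+t. of_bool (0 < t) * ennreal (t powr (\<gamma> - 1)) * F x t \<partial>lborel \<partial>lborel)"

lemma sets_nu:
  fixes P :: "'a::euclidean_space \<Rightarrow> real \<Rightarrow> bool"
  assumes [measurable]: "Measurable.pred (borel \<Otimes>\<^sub>M borel) (\<lambda>(x, t). P x t)"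
  shows "{(x, t). 0 < t \<and> P x t} \<in> sets (nu \<gamma>)"
proof -
  let ?S = "{(x, t). 0 < t \<and> P x t}"
  have "?S = {p \<in> space (borel \<Otimes>\<^sub>M borel). 0 < snd p \<and> (case p of (x, t) \<Rightarrow> P x t)}"
    by (auto simp: space_pair_measure)
  also have "\<dots> \<in> sets (borel \<Otimes>\<^sub>M borel)"
    by measurable
  finally have "?S \<in> sets borel"
    unfolding borel_prod[symmetric] .
  then show ?thesis
    by (auto simp: nu_def sets_restrict_space intro!: image_eqI[of _ _ ?S])
qed

lemma emeasure_nu:
  fixes P :: "'a::euclidean_space \<Rightarrow> real \<Rightarrow> bool"
  assumes P [measurable]: "Measurable.pred (borel \<Otimes>\<^sub>M borel) (\<lambda>(x, t). P x t)"
  shows "emeasure (nu \<gamma>) {(x, t). 0 < t \<and> P x t} = halfspace_integral \<gamma> (\<lambda>x t. of_bool (P x t))"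
proof -
  let ?U = "UNIV \<times> {0<..} :: ('a \<times> real) set"
  let ?S = "{(x, t). 0 < t \<and> P x t}"
  have U: "?U \<in> sets borel"
    by (intro borel_open open_Times) auto
  have "?S \<in> sets (restrict_space lborel ?U)"
    using sets_nu[OF P] by (simp add: nu_def)
  moreover have "(\<lambda>(x::'a, t). ennreal (t powr (\<gamma> - 1))) \<in> borel_measurable (restrict_space lborel ?U)"
    by (intro measurable_restrict_space1) (simp add: borel_prod[symmetric])
  ultimately have "emeasure (nu \<gamma>) ?S =
      (\<integral>\<^sup>+p. (case p of (x::'a, t) \<Rightarrow> ennreal (t powr (\<gamma> - 1))) * indicator ?S p
        \<partial>restrict_space lborel ?U)"
    unfolding nu_def by (rule emeasure_density[rotated])
  also have "\<dots> = (\<integral>\<^sup>+p. (case p of (x::'a, t) \<Rightarrow> ennreal (t powr (\<gamma> - 1))) * indicator ?S p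
        * indicator ?U p \<partial>lborel)"
    using U by (subst nn_integral_restrict_space) auto
  also have "\<dots> = (\<integral>\<^sup>+p. (case p of (x::'a, t) \<Rightarrow>
        of_bool (0 < t) * ennreal (t powr (\<gamma> - 1)) * of_bool (P x t)) \<partial>(lborel \<Otimes>\<^sub>M lborel))"
    unfolding lborel_prod by (intro nn_integral_cong) (auto simp: indicator_def)
  also have "\<dots> = halfspace_integral \<gamma> (\<lambda>x t. of_bool (P x t))"
    unfolding halfspace_integral_def
    by (subst lborel.nn_integral_fst[symmetric]) simp_all
  finally show ?thesis .
qed

lemma halfspace_integral_mono:
  assumes "\<And>x t. 0 < t \<Longrightarrow> F x t \<le> G x t"
  shows "halfspace_integral \<gamma> F \<le> halfspace_integral \<gamma> G"
  unfolding halfspace_integral_def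
proof (intro nn_integral_mono)
  fix x t
  show "of_bool (0 < t) * ennreal (t powr (\<gamma> - 1)) * F x t \<le> of_bool (0 < t) * ennreal (t powr (\<gamma> - 1)) * G x t"
    using assms[of t x] by (cases "0 < t") (auto intro: mult_left_mono)
qed

lemma halfspace_integral_cmult:
  assumes [measurable]: "(\<lambda>(x, t). F x t) \<in> borel_measurable (borel \<Otimes>\<^sub>M borel)"
  shows "halfspace_integral \<gamma> (\<lambda>x t. c * F x t) = c * halfspace_integral \<gamma> F"
proof -
  have "halfspace_integral \<gamma> (\<lambda>x t. c * F x t) =
      (\<integral>\<^sup>+x. \<integral>\<^sup>+t. c * (of_bool (0 < t) * ennreal (t powr (\<gamma> - 1)) * F x t) \<partial>lborel \<partial>lborel)"
    unfolding halfspace_integral_def by (simp add: mult_ac)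
  also have "\<dots> = c * halfspace_integral \<gamma> F"
    unfolding halfspace_integral_def by (simp add: nn_integral_cmult)
  finally show ?thesis .
qed

lemma halfspace_integral_add:
  assumes [measurable]: "(\<lambda>(x, t). F x t) \<in> borel_measurable (borel \<Otimes>\<^sub>M borel)"
    "(\<lambda>(x, t). G x t) \<in> borel_measurable (borel \<Otimes>\<^sub>M borel)"
  shows "halfspace_integral \<gamma> (\<lambda>x t. F x t + G x t) = halfspace_integral \<gamma> F + halfspace_integral \<gamma> G"
  unfolding halfspace_integral_def
  by (subst nn_integral_add[symmetric]; simp add: nn_integral_add[symmetric] distrib_left)

lemma halfspace_integral_suminf:
  assumes [measurable]: "\<And>i::nat. (\<lambda>(x, t). F i x t) \<in> borel_measurable (borel \<Otimes>\<^sub>M borel)"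
  shows "halfspace_integral \<gamma> (\<lambda>x t. \<Sum>i. F i x t) = (\<Sum>i. halfspace_integral \<gamma> (F i))"
  unfolding halfspace_integral_def
  by (subst nn_integral_suminf[symmetric]; simp add: nn_integral_suminf[symmetric])

lemma halfspace_integral_dilate:
  assumes [measurable]: "(\<lambda>(x, t). F x t) \<in> borel_measurable (borel \<Otimes>\<^sub>M borel)" and c: "0 < c"
  shows "halfspace_integral \<gamma> (\<lambda>x t. F x (c * t)) = ennreal (c powr - \<gamma>) * halfspace_integral \<gamma> F"
proof -
  have *: "(\<integral>\<^sup>+t. of_bool (0 < t) * ennreal (t powr (\<gamma> - 1)) * F x (c * t) \<partial>lborel) =
      ennreal (c powr - \<gamma>) * (\<integral>\<^sup>+t. of_bool (0 < t) * ennreal (t powr (\<gamma> - 1)) * F x t \<partial>lborel)" for x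
  proof -
    have "ennreal (c powr - \<gamma>) * (\<integral>\<^sup>+t. of_bool (0 < t) * ennreal (t powr (\<gamma> - 1)) * F x t \<partial>lborel) =
       ennreal (c powr - \<gamma>) * (ennreal c *
         (\<integral>\<^sup>+t. of_bool (0 < c * t) * ennreal ((c * t) powr (\<gamma> - 1)) * F x (c * t) \<partial>lborel))"
      using c by (subst nn_integral_real_affine[where c=c and t=0]) auto
    also have "\<dots> = (\<integral>\<^sup>+t. ennreal (c powr - \<gamma>) * (ennreal c *
        (of_bool (0 < c * t) * ennreal ((c * t) powr (\<gamma> - 1)) * F x (c * t))) \<partial>lborel)"
      by (simp add: nn_integral_cmult)
    also have "\<dots> = (\<integral>\<^sup>+t. of_bool (0 < t) * ennreal (t powr (\<gamma> - 1)) * F x (c * t) \<partial>lborel)"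
    proof (intro nn_integral_cong)
      fix t :: real
      show "ennreal (c powr - \<gamma>) * (ennreal c *
            (of_bool (0 < c * t) * ennreal ((c * t) powr (\<gamma> - 1)) * F x (c * t))) =
          of_bool (0 < t) * ennreal (t powr (\<gamma> - 1)) * F x (c * t)"
      proof (cases "0 < t")
        case True
        have "c powr - \<gamma> * (c * (c * t) powr (\<gamma> - 1)) = t powr (\<gamma> - 1)"
          using c True by (simp add: powr_mult powr_diff powr_minus field_simps)
        then have "ennreal (c powr - \<gamma>) * (ennreal c * ennreal ((c * t) powr (\<gamma> - 1))) = ennreal (t powr (\<gamma> - 1))"
          using c by (simp flip: ennreal_mult)
        then show ?thesis
          using c True by (simp add: mult.assoc[symmetric])
      qed (use c in \<open>simp add: zero_less_mult_iff\<close>)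
    qed
    finally show ?thesis by simp
  qed
  show ?thesis
    unfolding halfspace_integral_def * by (simp add: nn_integral_cmult)
qed

section \<open>Truncated potentials of a doubling radial kernel\<close>

text \<open>
  The doubling condition says that \<open>r^(n + \<gamma>/2) \<Phi>(r)\<close> is nondecreasing.  The exponent lies strictly
  between \<open>n\<close>, which leaves room for \<open>\<Phi>(|x|)\<close> to be integrable, and \<open>n + \<gamma>\<close>, which makes
  \<open>t^-(n + \<gamma>) \<Phi>(r/t)\<close> decay in \<open>t\<close>.
\<close>
locale doubling_kernel =
  fixes \<gamma> :: real and \<Phi> :: "real \<Rightarrow> ennreal" and g :: "'a::euclidean_space \<Rightarrow> ennreal"
  assumes gamma_pos: "0 < \<gamma>"
    and antimono: "antimono \<Phi>"
    and doubling: "\<And>r \<kappa>. 0 \<le> r \<Longrightarrow> 1 \<le> \<kappa> \<Longrightarrow> \<Phi> r \<le> ennreal (\<kappa> powr (DIM('a) + \<gamma> / 2)) * \<Phi> (\<kappa> * r)"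
    and density_measurable [measurable]: "g \<in> borel_measurable borel"
begin

lemma profile_measurable [measurable]: "\<Phi> \<in> borel_measurable borel"
  by (rule borel_measurable_antimono_ennreal[OF antimono])

definition kernel :: "real \<Rightarrow> real \<Rightarrow> ennreal" where
  "kernel r t = ennreal (t powr - (DIM('a) + \<gamma>)) * \<Phi> (r / t)"

text \<open>
  Capping the distance from below at \<open>\<rho>\<close> keeps only the behaviour of \<open>g\<close> at distances above \<open>\<rho>\<close> and
  treats the mass nearer to \<open>x\<close> as if it were spread over the ball of radius \<open>\<rho>\<close>.  It plays the
  part of an average over a dyadic cube of side \<open>\<rho>\<close>.
\<close>
definition potential :: "'a \<Rightarrow> real \<Rightarrow> real \<Rightarrow> ennreal" where
  "potential x \<rho> t = (\<integral>\<^sup>+y. g y * kernel (max (norm (x - y)) \<rho>) t \<partial>lborel)"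

lemma kernel_measurable [measurable (raw)]:
  assumes [measurable]: "r \<in> borel_measurable M" "t \<in> borel_measurable M"
  shows "(\<lambda>z. kernel (r z) (t z)) \<in> borel_measurable M"
  unfolding kernel_def by measurable

lemma potential_measurable [measurable (raw)]:
  assumes [measurable]: "x \<in> borel_measurable M" "\<rho> \<in> borel_measurable M" "t \<in> borel_measurable M"
  shows "(\<lambda>z. potential (x z) (\<rho> z) (t z)) \<in> borel_measurable M"
  unfolding potential_def by measurable

lemma kernel_antimono: "0 < t \<Longrightarrow> r \<le> r' \<Longrightarrow> kernel r' t \<le> kernel r t"
  unfolding kernel_def by (intro mult_left_mono antimonoD[OF antimono]) (auto simp: divide_right_mono)

lemma kernel_decay:
  assumes "0 < t" "t \<le> t'" "0 \<le> r"
  shows "kernel r t' \<le> ennreal ((t / t') powr (\<gamma> / 2)) * kernel r t"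
proof -
  let ?m = "DIM('a) + \<gamma> / 2"
  have "\<Phi> (r / t') \<le> ennreal ((t' / t) powr ?m) * \<Phi> ((t' / t) * (r / t'))"
    using assms by (intro doubling) auto
  also have "(t' / t) * (r / t') = r / t"
    using assms by auto
  finally have "kernel r t' \<le> ennreal (t' powr - (DIM('a) + \<gamma>)) * (ennreal ((t' / t) powr ?m) * \<Phi> (r / t))"
    unfolding kernel_def by (intro mult_left_mono) auto
  also have "\<dots> = ennreal (t' powr - (DIM('a) + \<gamma>) * (t' / t) powr ?m) * \<Phi> (r / t)"
    by (simp add: ennreal_mult mult.assoc)
  also have "t' powr - (DIM('a) + \<gamma>) * (t' / t) powr ?m
      = (t / t') powr (\<gamma> / 2) * t powr - (DIM('a) + \<gamma>)"
  proof -
    have "t' powr - (DIM('a) + \<gamma>) * (t' / t) powr ?m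
        = exp (- (DIM('a) + \<gamma>) * ln t' + ?m * (ln t' - ln t))"
      using assms by (simp add: powr_def exp_add ln_div)
    also have "\<dots> = exp (\<gamma> / 2 * (ln t - ln t') + - (DIM('a) + \<gamma>) * ln t)"
      by (simp add: field_simps)
    also have "\<dots> = (t / t') powr (\<gamma> / 2) * t powr - (DIM('a) + \<gamma>)"
      using assms by (simp add: powr_def exp_add ln_div)
    finally show ?thesis .
  qed
  finally show ?thesis
    by (simp add: kernel_def ennreal_mult mult.assoc)
qed

lemma potential_antimono_radius:
  "0 < t \<Longrightarrow> \<rho> \<le> \<rho>' \<Longrightarrow> potential x \<rho>' t \<le> potential x \<rho> t"
  unfolding potential_def by (intro nn_integral_mono mult_left_mono kernel_antimono) auto

lemma potential_decay:
  assumes "0 < t" "t \<le> t'"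
  shows "potential x \<rho> t' \<le> ennreal ((t / t') powr (\<gamma> / 2)) * potential x \<rho> t"
proof -
  have "potential x \<rho> t' \<le> (\<integral>\<^sup>+y. ennreal ((t / t') powr (\<gamma> / 2)) *
      (g y * kernel (max (norm (x - y)) \<rho>) t) \<partial>lborel)"
    unfolding potential_def
  proof (intro nn_integral_mono)
    fix y
    show "g y * kernel (max (norm (x - y)) \<rho>) t' \<le>
        ennreal ((t / t') powr (\<gamma> / 2)) * (g y * kernel (max (norm (x - y)) \<rho>) t)"
      using kernel_decay[OF assms, of "max (norm (x - y)) \<rho>"]
      by (subst mult.left_commute) (intro mult_left_mono, auto simp: le_max_iff_disj)
  qed
  then show ?thesis
    unfolding potential_def by (simp add: nn_integral_cmult)
qed

lemma potential_antimono_time: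
  assumes "0 < t" "t \<le> t'"
  shows "potential x \<rho> t' \<le> potential x \<rho> t"
proof -
  have "ennreal ((t / t') powr (\<gamma> / 2)) \<le> 1"
    using assms gamma_pos by (auto simp: ennreal_le_1 intro: powr_le1)
  then have "ennreal ((t / t') powr (\<gamma> / 2)) * potential x \<rho> t \<le> 1 * potential x \<rho> t"
    by (rule mult_right_mono) simp
  with potential_decay[OF assms] show ?thesis
    by (auto intro: order_trans)
qed

text \<open>
  Dividing the time by this number raises the potential at least by the factor \<open>2^(n + \<gamma>/2)\<close> that is lost
  when a distance doubles.
\<close>
definition dilation :: real where
  "dilation = 2 powr ((DIM('a) + \<gamma> / 2) * (2 / \<gamma>))"

lemma dilation_ge_1: "1 \<le> dilation"
  using gamma_pos by (auto simp: dilation_def intro!: ge_one_powr_ge_zero)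

text \<open>
  For \<open>|x - y| \<le> \<rho>\<close> the capped distances from \<open>x\<close> and from \<open>y\<close> differ at most by a factor 2.  The
  constant lost in the kernel is bought back by the decay in time, so that the same level \<open>e\<close> can be
  used at both points.
\<close>
lemma potential_shift:
  assumes "norm (x - y) \<le> \<rho>" "0 < t"
  shows "potential x \<rho> t \<le> potential y \<rho> (t / dilation)"
  unfolding potential_def
proof (intro nn_integral_mono mult_left_mono)
  fix z
  let ?m = "DIM('a) + \<gamma> / 2"
  define a b where "a = max (norm (x - z)) \<rho>" and "b = max (norm (y - z)) \<rho>"
  have "norm (y - z) \<le> norm (x - z) + norm (x - y)"
    using norm_triangle_ineq[of "x - z" "y - x"] by (simp add: norm_minus_commute)
  then have "b \<le> 2 * a" "0 \<le> a" "0 \<le> b"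
    using assms(1) norm_ge_zero[of "x - y"] norm_ge_zero[of "x - z"] unfolding a_def b_def max_def
    by (auto split: if_splits simp del: norm_ge_zero)
  have "\<Phi> (a / t) \<le> ennreal (2 powr ?m) * \<Phi> (2 * (a / t))"
    using \<open>0 \<le> a\<close> assms by (intro doubling) auto
  then have "kernel a t \<le> ennreal (2 powr ?m) * kernel (2 * a) t"
    unfolding kernel_def
    by (subst mult.left_commute) (intro mult_left_mono, auto)
  also have "\<dots> \<le> ennreal (2 powr ?m) * kernel b t"
    using \<open>b \<le> 2 * a\<close> assms by (intro mult_left_mono kernel_antimono) auto
  also have "\<dots> \<le> ennreal (2 powr ?m) * (ennreal (((t / dilation) / t) powr (\<gamma> / 2)) * kernel b (t / dilation))"
    using \<open>0 \<le> b\<close> assms dilation_ge_1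
    by (intro mult_left_mono kernel_decay) (auto simp: divide_le_eq mult_le_cancel_left1)
  also have "\<dots> = ennreal (2 powr ?m * (1 / dilation) powr (\<gamma> / 2)) * kernel b (t / dilation)"
    using assms by (simp add: ennreal_mult mult.assoc)
  also have "2 powr ?m * (1 / dilation) powr (\<gamma> / 2) = 1"
  proof -
    have "?m * (2 / \<gamma>) * (\<gamma> / 2) = ?m"
      using gamma_pos by (simp only: mult.assoc) simp
    then have "dilation powr (\<gamma> / 2) = 2 powr ?m"
      by (simp only: dilation_def powr_powr)
    then show ?thesis
      using dilation_ge_1 by (simp add: powr_divide)
  qed
  finally show "kernel (max (norm (x - z)) \<rho>) t \<le> kernel (max (norm (y - z)) \<rho>) (t / dilation)"
    by (simp add: a_def b_def)
qed auto

text \<open>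
  The points \<open>y\<close> that are selected lie outside a ball about \<open>x\<close>.  If \<open>\<rho>\<close> is the radius of that ball,
  then capping at \<open>\<rho>\<close> changes nothing on the domain of integration, so the integral is at most
  \<open>potential x \<rho> t\<close>.  The limiting sequence of radii is needed only because the level condition may
  fail at \<open>\<rho>\<close> itself.
\<close>
lemma nn_integral_below_level:
  assumes t: "0 < t"
  shows "(\<integral>\<^sup>+y. g y * kernel (norm (x - y)) t * of_bool (potential x (norm (x - y)) t \<le> e) \<partial>lborel) \<le> e"
proof (cases "\<exists>\<rho>\<ge>0. potential x \<rho> t \<le> e")
  case False
  then have "(\<integral>\<^sup>+y. g y * kernel (norm (x - y)) t * of_bool (potential x (norm (x - y)) t \<le> e) \<partial>lborel) = 0"
    by (subst nn_integral_cong[where v = "\<lambda>_. 0"]) auto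
  then show ?thesis by simp
next
  case True
  \<comment> \<open>Since the potential decreases in the radius, \<open>S\<close> is an upper half line, closed or open at its end.\<close>
  define S where "S = {\<rho>. 0 \<le> \<rho> \<and> potential x \<rho> t \<le> e}"
  define m where "m = Inf S"
  have S: "S \<noteq> {}" "bdd_below S"
    using True by (auto simp: S_def intro!: bdd_belowI[of _ 0])
  have up: "\<rho>' \<in> S" if "\<rho> \<in> S" "\<rho> \<le> \<rho>'" for \<rho> \<rho>'
    using that potential_antimono_radius[OF t, of \<rho> \<rho>' x] by (auto simp: S_def)
  define \<rho> where "\<rho> i = (if m \<in> S then m else m + 1 / real (Suc i))" for i
  have \<rho>_S: "\<rho> i \<in> S" for i
  proof (cases "m \<in> S")
    case False
    have "m < m + 1 / real (Suc i)" by simp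
    then obtain s where "s \<in> S" "s < m + 1 / real (Suc i)"
      unfolding m_def using S by (subst (asm) cInf_less_iff) (auto simp: m_def)
    with False show ?thesis
      unfolding \<rho>_def by (simp add: up)
  qed (simp add: \<rho>_def)
  have \<rho>_dec: "\<rho> (Suc i) \<le> \<rho> i" for i
    by (auto simp: \<rho>_def intro!: divide_left_mono)
  have reach: "\<exists>i. \<rho> i \<le> s" if "s \<in> S" for s
  proof (cases "m \<in> S")
    case True
    then show ?thesis using that S by (auto simp: \<rho>_def m_def intro: cInf_lower)
  next
    case False
    then have "m < s"
      using that S cInf_lower[of s S] by (cases "m = s") (auto simp: m_def)
    then obtain i where "inverse (real (Suc i)) < s - m"
      using reals_Archimedean[of "s - m"] by auto
    with False show ?thesis
      by (intro exI[of _ i]) (auto simp: \<rho>_def field_simps)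
  qed
  let ?f = "\<lambda>i y. g y * kernel (norm (x - y)) t * of_bool (\<rho> i \<le> norm (x - y))"
  have "(\<integral>\<^sup>+y. g y * kernel (norm (x - y)) t * of_bool (potential x (norm (x - y)) t \<le> e) \<partial>lborel)
      \<le> (\<integral>\<^sup>+y. (SUP i. ?f i y) \<partial>lborel)"
  proof (intro nn_integral_mono)
    fix y
    show "g y * kernel (norm (x - y)) t * of_bool (potential x (norm (x - y)) t \<le> e) \<le> (SUP i. ?f i y)"
    proof (cases "potential x (norm (x - y)) t \<le> e")
      case True
      then obtain i where "\<rho> i \<le> norm (x - y)"
        using reach[of "norm (x - y)"] by (auto simp: S_def)
      then show ?thesis
        using True by (intro SUP_upper2[of i]) auto
    qed simp
  qed
  also have "\<dots> = (SUP i. \<integral>\<^sup>+y. ?f i y \<partial>lborel)"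
  proof (intro nn_integral_monotone_convergence_SUP)
    show "incseq ?f"
    proof (rule incseq_SucI, rule le_funI)
      fix i y
      show "?f i y \<le> ?f (Suc i) y"
        using \<rho>_dec[of i] by (intro mult_left_mono) auto
    qed
  qed measurable
  also have "\<dots> \<le> e"
  proof (intro SUP_least)
    fix i
    have "(\<integral>\<^sup>+y. ?f i y \<partial>lborel) \<le> potential x (\<rho> i) t"
      unfolding potential_def by (intro nn_integral_mono) (auto simp: max_absorb1)
    also have "\<dots> \<le> e"
      using \<rho>_S[of i] by (simp add: S_def)
    finally show "(\<integral>\<^sup>+y. ?f i y \<partial>lborel) \<le> e" .
  qed
  finally show ?thesis .
qed


section \<open>Charging half-space mass to the density\<close>

text \<open>
  If \<open>\<alpha> t' \<ge> \<beta> t\<close> held for two times in the set, then both the radius and the time would be larger in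
  \<open>potential y (t' * r) (\<alpha> * t')\<close> than in \<open>potential y (t * r) (\<beta> * t)\<close>; monotonicity in both would put
  the former below the level \<open>e\<close>.  So any two times of the set have a ratio below \<open>\<beta>/\<alpha>\<close>.
\<close>
lemma potential_level_log_length:
  assumes r: "0 \<le> r" and ab: "0 < \<alpha>" "\<alpha> \<le> \<beta>"
  shows "(\<integral>\<^sup>+t. of_bool (0 < t) * ennreal (1 / t) *
      of_bool (potential y (t * r) (\<beta> * t) \<le> e \<and> e < potential y (t * r) (\<alpha> * t)) \<partial>lborel)
    \<le> ennreal (2 * ln (\<beta> / \<alpha>))"
proof -
  define T where "T = {t. 0 < t \<and> potential y (t * r) (\<beta> * t) \<le> e \<and> e < potential y (t * r) (\<alpha> * t)}"
  have less: "\<alpha> * t' < \<beta> * t" if "t \<in> T" "t' \<in> T" for t t'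
  proof (rule ccontr)
    assume "\<not> \<alpha> * t' < \<beta> * t"
    then have le: "\<beta> * t \<le> \<alpha> * t'" by simp
    have pos: "0 < t" "0 < t'" using that by (auto simp: T_def)
    have "\<alpha> * t \<le> \<alpha> * t'"
      using le ab pos mult_right_mono[of \<alpha> \<beta> t] by linarith
    then have "t \<le> t'" using ab by simp
    have "e < potential y (t' * r) (\<alpha> * t')"
      using that by (simp add: T_def)
    also have "\<dots> \<le> potential y (t * r) (\<alpha> * t')"
      using \<open>t \<le> t'\<close> r ab pos by (intro potential_antimono_radius mult_right_mono) auto
    also have "\<dots> \<le> potential y (t * r) (\<beta> * t)"
      using le ab pos by (intro potential_antimono_time) auto
    also have "\<dots> \<le> e"
      using that by (simp add: T_def)
    finally show False by simp
  qed
  show ?thesis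
  proof (cases "T = {}")
    case True
    then have "(\<integral>\<^sup>+t. of_bool (0 < t) * ennreal (1 / t) *
      of_bool (potential y (t * r) (\<beta> * t) \<le> e \<and> e < potential y (t * r) (\<alpha> * t)) \<partial>lborel) = 0"
      by (subst nn_integral_cong[where v = "\<lambda>_. 0"]) (auto simp: T_def)
    then show ?thesis by simp
  next
    case False
    then obtain s where s: "s \<in> T" by auto
    then have "0 < s" by (simp add: T_def)
    define a b where "a = s * \<alpha> / \<beta>" and "b = s * \<beta> / \<alpha>"
    have "0 < a" "a \<le> s" "s \<le> b"
      using \<open>0 < s\<close> ab by (auto simp: a_def b_def field_simps)
    have sub: "T \<subseteq> {a..b}"
    proof
      fix t assume t: "t \<in> T"
      show "t \<in> {a..b}"
        using less[OF s t] less[OF t s] ab by (auto simp: a_def b_def field_simps)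
    qed
    have "(\<integral>\<^sup>+t. of_bool (0 < t) * ennreal (1 / t) *
        of_bool (potential y (t * r) (\<beta> * t) \<le> e \<and> e < potential y (t * r) (\<alpha> * t)) \<partial>lborel)
      \<le> (\<integral>\<^sup>+t. ennreal (1 / t) * indicator {a..b} t \<partial>lborel)"
      using sub by (intro nn_integral_mono) (auto simp: T_def indicator_def)
    also have "\<dots> = ennreal (ln b - ln a)"
      using \<open>0 < a\<close> \<open>a \<le> s\<close> \<open>s \<le> b\<close>
      by (intro nn_integral_FTC_Icc) (auto intro!: derivative_eq_intros)
    also have "ln b - ln a = 2 * ln (\<beta> / \<alpha>)"
      using \<open>0 < s\<close> ab by (simp add: a_def b_def ln_div ln_mult)
    finally show ?thesis .
  qed
qed


text \<open>
  The charging estimate.  The weight \<open>t^(\<gamma> - 1)\<close> of the measure and the factor \<open>t^-(n + \<gamma>)\<close> of the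
  kernel leave \<open>t^-n dt/t\<close>.  The substitution \<open>x = y + t w\<close> absorbs \<open>t^-n\<close> and decouples \<open>H\<close> from \<open>t\<close>, so
  only the logarithmic length of the admissible times remains.
\<close>
lemma charging:
  assumes [measurable]: "H \<in> borel_measurable borel" and ab: "0 < \<alpha>" "\<alpha> \<le> \<beta>"
  shows "halfspace_integral \<gamma> (\<lambda>x t. \<integral>\<^sup>+y. g y * (ennreal (t powr - (DIM('a) + \<gamma>)) * H ((x - y) /\<^sub>R t)) *
      of_bool (potential y (norm (x - y)) (\<beta> * t) \<le> e \<and> e < potential y (norm (x - y)) (\<alpha> * t)) \<partial>lborel)
    \<le> ennreal (2 * ln (\<beta> / \<alpha>)) * ((\<integral>\<^sup>+y. g y \<partial>lborel) * (\<integral>\<^sup>+w. H w \<partial>lborel))"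
proof -
  define Q where "Q y r t = (of_bool (potential y r (\<beta> * t) \<le> e \<and> e < potential y r (\<alpha> * t)) :: ennreal)" for y r t
  have [measurable (raw)]: "(\<lambda>z. Q (y z) (r z) (t z)) \<in> borel_measurable M"
    if [measurable]: "y \<in> borel_measurable M" "r \<in> borel_measurable M" "t \<in> borel_measurable M"
    for y :: "'b \<Rightarrow> 'a" and r t and M :: "'b measure"
    unfolding Q_def by measurable
  define J where "J x t y = of_bool (0 < t) * ennreal (t powr (\<gamma> - 1)) *
      (g y * (ennreal (t powr - (DIM('a) + \<gamma>)) * H ((x - y) /\<^sub>R t)) * Q y (norm (x - y)) t)" for x y :: 'a and t
  have [measurable (raw)]: "(\<lambda>z. J (x z) (t z) (y z)) \<in> borel_measurable M"
    if [measurable]: "x \<in> borel_measurable M" "t \<in> borel_measurable M" "y \<in> borel_measurable M"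
    for x y :: "'b \<Rightarrow> 'a" and t and M :: "'b measure"
    unfolding J_def by measurable
  have scale: "(\<integral>\<^sup>+x. J x t y \<partial>lborel) =
      (\<integral>\<^sup>+w. g y * H w * (of_bool (0 < t) * ennreal (1 / t) * Q y (t * norm w) t) \<partial>lborel)" for y t
  proof (cases "0 < t")
    case True
    have "(\<integral>\<^sup>+x. J x t y \<partial>lborel) = ennreal (\<bar>t\<bar> ^ DIM('a)) * (\<integral>\<^sup>+w. J (y + t *\<^sub>R w) t y \<partial>lborel)"
      using True by (intro nn_integral_affine) auto
    also have "\<dots> = (\<integral>\<^sup>+w. ennreal (\<bar>t\<bar> ^ DIM('a)) * J (y + t *\<^sub>R w) t y \<partial>lborel)"
      by (simp add: nn_integral_cmult)
    also have "\<dots> = (\<integral>\<^sup>+w. g y * H w * (of_bool (0 < t) * ennreal (1 / t) * Q y (t * norm w) t) \<partial>lborel)"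
    proof (intro nn_integral_cong)
      fix w
      have "t ^ DIM('a) * (t powr (\<gamma> - 1) * t powr - (DIM('a) + \<gamma>)) = 1 / t"
        using True by (simp add: powr_realpow[symmetric] powr_add[symmetric] powr_minus_divide)
      then have "ennreal (\<bar>t\<bar> ^ DIM('a)) * (ennreal (t powr (\<gamma> - 1)) * ennreal (t powr - (DIM('a) + \<gamma>))) = ennreal (1 / t)"
        using True by (simp flip: ennreal_mult)
      moreover have "ennreal (\<bar>t\<bar> ^ DIM('a)) * J (y + t *\<^sub>R w) t y =
          g y * H w * ((ennreal (\<bar>t\<bar> ^ DIM('a)) * (ennreal (t powr (\<gamma> - 1)) * ennreal (t powr - (DIM('a) + \<gamma>)))) * Q y (t * norm w) t)"
        using True by (simp add: J_def mult_ac)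
      ultimately show "ennreal (\<bar>t\<bar> ^ DIM('a)) * J (y + t *\<^sub>R w) t y =
          g y * H w * (of_bool (0 < t) * ennreal (1 / t) * Q y (t * norm w) t)"
        using True by simp
    qed
    finally show ?thesis .
  qed (simp add: J_def)
  have "halfspace_integral \<gamma> (\<lambda>x t. \<integral>\<^sup>+y. g y * (ennreal (t powr - (DIM('a) + \<gamma>)) * H ((x - y) /\<^sub>R t)) *
      Q y (norm (x - y)) t \<partial>lborel) = (\<integral>\<^sup>+x. \<integral>\<^sup>+t. \<integral>\<^sup>+y. J x t y \<partial>lborel \<partial>lborel \<partial>lborel)"
    unfolding halfspace_integral_def J_def by (simp add: nn_integral_cmult)
  also have "\<dots> = (\<integral>\<^sup>+x. \<integral>\<^sup>+y. \<integral>\<^sup>+t. J x t y \<partial>lborel \<partial>lborel \<partial>lborel)"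
    by (intro nn_integral_cong lborel_pair.Fubini'[symmetric]) measurable
  also have "\<dots> = (\<integral>\<^sup>+y. \<integral>\<^sup>+x. \<integral>\<^sup>+t. J x t y \<partial>lborel \<partial>lborel \<partial>lborel)"
    by (intro lborel_pair.Fubini'[symmetric]) measurable
  also have "\<dots> = (\<integral>\<^sup>+y. \<integral>\<^sup>+t. \<integral>\<^sup>+x. J x t y \<partial>lborel \<partial>lborel \<partial>lborel)"
    by (intro nn_integral_cong lborel_pair.Fubini'[symmetric]) measurable
  also have "\<dots> = (\<integral>\<^sup>+y. \<integral>\<^sup>+t. \<integral>\<^sup>+w. g y * H w * (of_bool (0 < t) * ennreal (1 / t) * Q y (t * norm w) t)
      \<partial>lborel \<partial>lborel \<partial>lborel)"
    by (simp only: scale)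
  also have "\<dots> = (\<integral>\<^sup>+y. \<integral>\<^sup>+w. \<integral>\<^sup>+t. g y * H w * (of_bool (0 < t) * ennreal (1 / t) * Q y (t * norm w) t)
      \<partial>lborel \<partial>lborel \<partial>lborel)"
    by (intro nn_integral_cong lborel_pair.Fubini'[symmetric]) measurable
  also have "\<dots> \<le> (\<integral>\<^sup>+y. \<integral>\<^sup>+w. g y * H w * ennreal (2 * ln (\<beta> / \<alpha>)) \<partial>lborel \<partial>lborel)"
  proof (intro nn_integral_mono)
    fix y w
    have "(\<integral>\<^sup>+t. g y * H w * (of_bool (0 < t) * ennreal (1 / t) * Q y (t * norm w) t) \<partial>lborel) =
        g y * H w * (\<integral>\<^sup>+t. of_bool (0 < t) * ennreal (1 / t) * Q y (t * norm w) t \<partial>lborel)"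
      by (intro nn_integral_cmult) measurable
    also have "\<dots> \<le> g y * H w * ennreal (2 * ln (\<beta> / \<alpha>))"
      unfolding Q_def using ab by (intro mult_left_mono potential_level_log_length) auto
    finally show "(\<integral>\<^sup>+t. g y * H w * (of_bool (0 < t) * ennreal (1 / t) * Q y (t * norm w) t) \<partial>lborel)
        \<le> g y * H w * ennreal (2 * ln (\<beta> / \<alpha>))" .
  qed
  also have "\<dots> = ennreal (2 * ln (\<beta> / \<alpha>)) * ((\<integral>\<^sup>+y. g y \<partial>lborel) * (\<integral>\<^sup>+w. H w \<partial>lborel))"
    by (simp add: nn_integral_cmult nn_integral_multc mult_ac)
  finally show ?thesis
    unfolding Q_def .
qed


section \<open>The exceptional set\<close>

text \<open>
  Dividing the time by this number at least doubles the potential.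
\<close>
definition half_time :: real where
  "half_time = 2 powr (2 / \<gamma>)"

lemma half_time_ge_1: "1 \<le> half_time"
  using gamma_pos by (auto simp: half_time_def intro!: ge_one_powr_ge_zero)

lemma kernel_half_time:
  assumes "0 < t" "0 \<le> r"
  shows "2 * kernel r t \<le> kernel r (t / half_time)"
proof -
  have B: "0 < half_time" "half_time powr (\<gamma> / 2) = 2"
    using gamma_pos by (simp_all add: half_time_def powr_powr)
  have "2 * kernel r t \<le> 2 * (ennreal ((t / half_time / t) powr (\<gamma> / 2)) * kernel r (t / half_time))"
    using assms half_time_ge_1 B
    by (intro mult_left_mono kernel_decay) (auto simp: divide_le_eq mult_le_cancel_left1)
  also have "(t / half_time / t) powr (\<gamma> / 2) = 1 / 2"
    using assms B by (simp add: powr_divide)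
  also have "2 * (ennreal (1 / 2) * kernel r (t / half_time)) = kernel r (t / half_time)"
  proof -
    have "2 * ennreal (1 / 2) = 1"
      using ennreal_mult[of 2 "1 / 2"] by simp
    then show ?thesis
      by (simp only: mult.assoc[symmetric] mult_1)
  qed
  finally show ?thesis .
qed

text \<open>
  Points \<open>y\<close> for which the potential of \<open>x\<close> at distance \<open>|x - y|\<close> is below \<open>e\<close> already at the time
  \<open>t / half_time\<close> contribute at most \<open>e / 2\<close> to \<open>potential x 0 t > e\<close>.  The other points carry the
  rest.  For them the crossing time at distance \<open>|x - y|\<close> lies between \<open>t / half_time\<close> and
  \<open>2 t\<close>, and \<open>potential_shift\<close> moves both ends from \<open>x\<close> to \<open>y\<close>.
\<close>
lemma exceptional_charge:
  assumes t: "0 < t" and e: "e < \<infinity>"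
    and big: "e < potential x 0 t" and small: "potential x 0 (2 * t) \<le> e"
  shows "e \<le> 2 * (\<integral>\<^sup>+y. g y * kernel (norm (x - y)) t *
      of_bool (potential y (norm (x - y)) (2 * dilation * t) \<le> e \<and>
        e < potential y (norm (x - y)) (1 / (dilation * half_time) * t)) \<partial>lborel)"
    (is "_ \<le> 2 * ?X")
proof -
  let ?low = "\<lambda>y. potential x (norm (x - y)) (t / half_time) \<le> e"
  let ?f = "\<lambda>y. g y * kernel (norm (x - y)) t"
  have pos: "0 < t / half_time" "0 < dilation" "0 < half_time"
    using t half_time_ge_1 dilation_ge_1 by auto
  have low: "2 * (\<integral>\<^sup>+y. ?f y * of_bool (?low y) \<partial>lborel) \<le> e"
  proof -
    have "2 * (\<integral>\<^sup>+y. ?f y * of_bool (?low y) \<partial>lborel) = (\<integral>\<^sup>+y. g y * (2 * kernel (norm (x - y)) t) * of_bool (?low y) \<partial>lborel)"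
      by (subst nn_integral_cmult[symmetric]) (auto simp: mult_ac)
    also have "\<dots> \<le> (\<integral>\<^sup>+y. g y * kernel (norm (x - y)) (t / half_time) * of_bool (?low y) \<partial>lborel)"
      using t by (intro nn_integral_mono mult_right_mono mult_left_mono kernel_half_time) auto
    also have "\<dots> \<le> e"
      using pos by (intro nn_integral_below_level) auto
    finally show ?thesis .
  qed
  have high: "(\<integral>\<^sup>+y. ?f y * of_bool (\<not> ?low y) \<partial>lborel) \<le> ?X"
  proof (intro nn_integral_mono mult_left_mono)
    fix y
    let ?r = "norm (x - y)"
    have "potential y ?r (2 * dilation * t) \<le> potential x ?r (2 * dilation * t / dilation)"
      using t pos by (intro potential_shift) (auto simp: norm_minus_commute)
    also have "\<dots> \<le> potential x 0 (2 * t)"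
      using t pos by (auto intro!: potential_antimono_radius)
    finally have 1: "potential y ?r (2 * dilation * t) \<le> e"
      using small by simp
    have 2: "e < potential y ?r (1 / (dilation * half_time) * t)" if "\<not> ?low y"
    proof -
      have "e < potential x ?r (t / half_time)"
        using that by simp
      also have "\<dots> \<le> potential y ?r (t / half_time / dilation)"
        using pos by (intro potential_shift) auto
      finally show ?thesis by (simp add: mult_ac)
    qed
    show "(of_bool (\<not> ?low y) :: ennreal) \<le> of_bool (potential y ?r (2 * dilation * t) \<le> e \<and>
        e < potential y ?r (1 / (dilation * half_time) * t))"
      using 1 2 by (cases "?low y") auto
  qed auto
  have "e \<le> potential x 0 t"
    using big by simp
  also have "\<dots> = (\<integral>\<^sup>+y. ?f y * of_bool (?low y) + ?f y * of_bool (\<not> ?low y) \<partial>lborel)"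
    unfolding potential_def by (intro nn_integral_cong) (auto simp: max_absorb1)
  also have "\<dots> = (\<integral>\<^sup>+y. ?f y * of_bool (?low y) \<partial>lborel) + (\<integral>\<^sup>+y. ?f y * of_bool (\<not> ?low y) \<partial>lborel)"
    by (intro nn_integral_add) measurable
  also have "\<dots> \<le> (\<integral>\<^sup>+y. ?f y * of_bool (?low y) \<partial>lborel) + ?X"
    using high by (intro add_left_mono)
  finally have "2 * e \<le> 2 * ((\<integral>\<^sup>+y. ?f y * of_bool (?low y) \<partial>lborel) + ?X)"
    by (intro mult_left_mono) auto
  also have "\<dots> \<le> e + 2 * ?X"
    using low by (simp add: distrib_left add_right_mono)
  finally have "e + e \<le> e + 2 * ?X"
    by (simp only: mult_2)
  then show ?thesis
    using e by (auto simp: ennreal_add_left_cancel_le)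
qed

definition exceptional_const :: real where
  "exceptional_const = 1 / (1 - 2 powr - \<gamma>) * (2 * (2 * ln (2 * dilation / (1 / (dilation * half_time)))))"

lemma exceptional_const_nonneg: "0 \<le> exceptional_const"
proof -
  have "1 \<le> 2 * dilation * (dilation * half_time)"
    using dilation_ge_1 half_time_ge_1 by (intro mult_ge1_I) auto
  moreover have "2 powr - \<gamma> < 1"
    using gamma_pos by (simp add: powr_less_one)
  ultimately show ?thesis
    by (auto simp: exceptional_const_def intro!: mult_nonneg_nonneg divide_nonneg_nonneg)
qed

text \<open>
  Above each \<open>x\<close> the exceptional set is an interval of times starting at \<open>0\<close>.  Only its top dyadic layer
  can be charged.  The layers below are dilates of the top one, and their measures decrease
  geometrically because \<open>\<nu>\<^sub>\<gamma>\<close> scales like \<open>t^\<gamma>\<close>.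
\<close>
lemma exceptional_set_bound:
  assumes fin: "\<And>x t. 0 < t \<Longrightarrow> potential x 0 t < \<infinity>" and l: "0 < l"
  shows "ennreal l * halfspace_integral \<gamma> (\<lambda>x t. of_bool (ennreal l < potential x 0 t))
    \<le> ennreal exceptional_const * ((\<integral>\<^sup>+y. g y \<partial>lborel) * (\<integral>\<^sup>+w. \<Phi> (norm (w::'a)) \<partial>lborel))"
proof -
  define e where "e = ennreal l"
  define top_layer where "top_layer x t \<longleftrightarrow> e < potential x 0 t \<and> potential x 0 (2 * t) \<le> e" for x t
  have [measurable]: "Measurable.pred M (\<lambda>z. top_layer (x z) (t z))"
    if [measurable]: "x \<in> borel_measurable M" "t \<in> borel_measurable M" for x t and M :: "'b measure"
    unfolding top_layer_def by measurable
  have reach: "\<exists>i. top_layer x (2 ^ i * t)" if t: "0 < t" and big: "e < potential x 0 t" for x t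
  proof -
    obtain p where p: "potential x 0 t = ennreal p" "0 \<le> p"
      using fin[OF t, of x] by (cases "potential x 0 t") auto
    \<comment> \<open>The decay in time and the finiteness at \<open>t\<close> bring the potential below \<open>e\<close> after finitely many doublings; the last doubling before that is the top layer.\<close>
    define q where "q = 2 powr - (\<gamma> / 2)"
    have "q < 1"
      using gamma_pos by (simp add: q_def powr_less_one)
    then obtain j where j: "q ^ j < l / (p + 1)"
      using l p real_arch_pow_inv[of "l / (p + 1)" q] by auto
    have "potential x 0 (2 ^ j * t) \<le> ennreal ((t / (2 ^ j * t)) powr (\<gamma> / 2)) * potential x 0 t"
      using t by (intro potential_decay) (auto simp: mult_le_cancel_right1)
    also have "(t / (2 ^ j * t)) powr (\<gamma> / 2) = q ^ j"
      using t by (simp add: q_def powr_divide powr_minus two_power_powr power_divide inverse_eq_divide)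
    also have "ennreal (q ^ j) * potential x 0 t \<le> e"
    proof -
      have "q ^ j * (p + 1) < l" "0 \<le> q"
        using j p by (auto simp: field_simps q_def)
      then have "q ^ j * p \<le> l"
        by (smt (verit) distrib_left mult_cancel_left2 zero_le_power)
      then show ?thesis
        using \<open>0 \<le> q\<close> p by (simp add: e_def ennreal_mult[symmetric] ennreal_leI)
    qed
    finally have ex: "potential x 0 (2 ^ j * t) \<le> e" .
    define k where "k = (LEAST i. potential x 0 (2 ^ i * t) \<le> e)"
    have k: "potential x 0 (2 ^ k * t) \<le> e"
      unfolding k_def using ex by (rule LeastI)
    with big have "k \<noteq> 0" by (auto intro!: Nat.gr0I)
    then obtain i where i: "k = Suc i" by (cases k) auto
    then have "\<not> potential x 0 (2 ^ i * t) \<le> e"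
      using not_less_Least[of i "\<lambda>i. potential x 0 (2 ^ i * t) \<le> e"] by (simp add: k_def)
    with k i show ?thesis
      by (auto simp: top_layer_def mult.assoc intro!: exI[of _ i])
  qed
  let ?L = "ennreal (2 * ln (2 * dilation / (1 / (dilation * half_time)))) *
      ((\<integral>\<^sup>+y. g y \<partial>lborel) * (\<integral>\<^sup>+w. \<Phi> (norm (w::'a)) \<partial>lborel))"
  have top: "e * halfspace_integral \<gamma> (\<lambda>x t. of_bool (top_layer x t)) \<le> 2 * ?L"
  proof -
    let ?F = "\<lambda>x t. \<integral>\<^sup>+y. g y * kernel (norm (x - y)) t *
        of_bool (potential y (norm (x - y)) (2 * dilation * t) \<le> e \<and>
          e < potential y (norm (x - y)) (1 / (dilation * half_time) * t)) \<partial>lborel"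
    have "e * halfspace_integral \<gamma> (\<lambda>x t. of_bool (top_layer x t)) =
        halfspace_integral \<gamma> (\<lambda>x t. e * of_bool (top_layer x t))"
      by (intro halfspace_integral_cmult[symmetric]) measurable
    also have "\<dots> \<le> halfspace_integral \<gamma> (\<lambda>x t. 2 * ?F x t)"
    proof (intro halfspace_integral_mono)
      fix x and t :: real assume t: "0 < t"
      show "e * of_bool (top_layer x t) \<le> 2 * ?F x t"
      proof (cases "top_layer x t")
        case True
        then show ?thesis
          using exceptional_charge[OF t, of e x] by (simp add: top_layer_def e_def)
      qed simp
    qed
    also have "\<dots> = 2 * halfspace_integral \<gamma> ?F"
      by (intro halfspace_integral_cmult) measurable
    also have "halfspace_integral \<gamma> ?F = halfspace_integral \<gamma> (\<lambda>x t. \<integral>\<^sup>+y. g y *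
        (ennreal (t powr - (DIM('a) + \<gamma>)) * \<Phi> (norm ((x - y) /\<^sub>R t))) *
        of_bool (potential y (norm (x - y)) (2 * dilation * t) \<le> e \<and>
          e < potential y (norm (x - y)) (1 / (dilation * half_time) * t)) \<partial>lborel)"
      unfolding halfspace_integral_def
    proof (intro nn_integral_cong)
      fix x and t :: real
      show "of_bool (0 < t) * ennreal (t powr (\<gamma> - 1)) * ?F x t = of_bool (0 < t) * ennreal (t powr (\<gamma> - 1)) *
         (\<integral>\<^sup>+y. g y * (ennreal (t powr - (DIM('a) + \<gamma>)) * \<Phi> (norm ((x - y) /\<^sub>R t))) *
        of_bool (potential y (norm (x - y)) (2 * dilation * t) \<le> e \<and>
          e < potential y (norm (x - y)) (1 / (dilation * half_time) * t)) \<partial>lborel)"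
        by (cases "0 < t") (simp_all add: kernel_def divide_inverse mult.commute)
    qed
    also have "\<dots> \<le> ?L"
      using dilation_ge_1 half_time_ge_1 mult_mono[of 1 dilation 1 half_time]
      by (intro charging) (auto simp: divide_le_eq intro!: mult_ge1_I)
    finally show ?thesis by (simp add: mult_left_mono)
  qed
  have "e * halfspace_integral \<gamma> (\<lambda>x t. of_bool (e < potential x 0 t))
      \<le> e * halfspace_integral \<gamma> (\<lambda>x t. \<Sum>i. of_bool (top_layer x (2 ^ i * t)))"
  proof (intro mult_left_mono halfspace_integral_mono)
    fix x and t :: real assume "0 < t"
    show "(of_bool (e < potential x 0 t) :: ennreal) \<le> (\<Sum>i. of_bool (top_layer x (2 ^ i * t)))"
    proof (cases "e < potential x 0 t")
      case True
      then obtain i where "top_layer x (2 ^ i * t)"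
        using reach \<open>0 < t\<close> by blast
      then show ?thesis
        using sum_le_suminf[of "\<lambda>i. of_bool (top_layer x (2 ^ i * t)) :: ennreal" "{i}"] True by simp
    qed simp
  qed simp
  also have "\<dots> = e * (\<Sum>i. halfspace_integral \<gamma> (\<lambda>x t. of_bool (top_layer x (2 ^ i * t))))"
    by (subst halfspace_integral_suminf) auto
  also have "\<dots> = e * (\<Sum>i. ennreal ((2 powr - \<gamma>) ^ i) * halfspace_integral \<gamma> (\<lambda>x t. of_bool (top_layer x t)))"
  proof -
    have "halfspace_integral \<gamma> (\<lambda>x t. of_bool (top_layer x (2 ^ i * t))) =
        ennreal ((2 powr - \<gamma>) ^ i) * halfspace_integral \<gamma> (\<lambda>x t. of_bool (top_layer x t))" for i :: nat
    proof -
      show ?thesis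
        by (subst halfspace_integral_dilate[where F = "\<lambda>x t. of_bool (top_layer x t)"])
           (simp_all add: two_power_powr)
    qed
    then show ?thesis by simp
  qed
  also have "\<dots> = ennreal (1 / (1 - 2 powr - \<gamma>)) * (e * halfspace_integral \<gamma> (\<lambda>x t. of_bool (top_layer x t)))"
    using gamma_pos
    by (subst ennreal_suminf_multc, subst suminf_ennreal_geometric) (simp_all add: powr_less_one mult_ac)
  also have "\<dots> \<le> ennreal (1 / (1 - 2 powr - \<gamma>)) * (2 * ?L)"
    by (intro mult_left_mono top) auto
  also have "\<dots> = ennreal exceptional_const * ((\<integral>\<^sup>+y. g y \<partial>lborel) * (\<integral>\<^sup>+w. \<Phi> (norm (w::'a)) \<partial>lborel))"
    unfolding exceptional_const_def using gamma_pos
    by (subst ennreal_mult') (auto simp: powr_less_one less_imp_le ennreal_mult' mult_ac)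
  finally show ?thesis
    by (simp add: e_def)
qed


section \<open>Rough kernels off the exceptional set\<close>

text \<open>
  Bounding the weight by \<open>growth ^ s\<close> in the layer whose crossing time is \<open>t / 2 ^ s\<close> spends half of the
  exponential gain \<open>2^-(\<gamma> s/2)\<close> that this layer has.
\<close>
definition growth :: real where
  "growth = 2 powr (\<gamma> / 4)"

lemma growth_gt_1: "1 < growth"
  using gamma_pos by (simp add: growth_def)

lemma growth_gain: "0 < t \<Longrightarrow> ((t / 2 ^ s) / t) powr (\<gamma> / 2) = (1 / growth) ^ s * (1 / growth) ^ s"
  by (simp add: growth_def powr_divide two_power_powr power_divide power_mult_distrib[symmetric]
      powr_add[symmetric])

definition bounded_const :: real where
  "bounded_const = 1 / (1 - 1 / growth)"

lemma bounded_const_pos: "0 < bounded_const"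
  using growth_gt_1 by (simp add: bounded_const_def)

text \<open>
  In layer \<open>s\<close> the level condition holds at the time \<open>t / 2 ^ s\<close>, and passing from there to \<open>t\<close> gains
  \<open>growth ^ (2 * s)\<close>, of which the weight uses up \<open>growth ^ s\<close>.
\<close>
lemma moderate_part_bound:
  assumes t: "0 < t"
  shows "(\<integral>\<^sup>+y. (\<Sum>s. ennreal (growth ^ s) * (g y * kernel (norm (x - y)) t *
      of_bool (potential x (norm (x - y)) (t / 2 ^ s) \<le> e))) \<partial>lborel) \<le> ennreal bounded_const * e"
proof -
  let ?F = "\<lambda>s y. ennreal (growth ^ s) * (g y * kernel (norm (x - y)) t *
      of_bool (potential x (norm (x - y)) (t / 2 ^ s) \<le> e))"
  have "(\<integral>\<^sup>+y. ?F s y \<partial>lborel) \<le> ennreal ((1 / growth) ^ s) * e" for s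
  proof -
    let ?q = "growth ^ s * ((1 / growth) ^ s * (1 / growth) ^ s)"
    have "(\<integral>\<^sup>+y. ?F s y \<partial>lborel) \<le> (\<integral>\<^sup>+y. ennreal ?q * (g y * kernel (norm (x - y)) (t / 2 ^ s) *
        of_bool (potential x (norm (x - y)) (t / 2 ^ s) \<le> e)) \<partial>lborel)"
    proof (intro nn_integral_mono)
      fix y
      have "kernel (norm (x - y)) t \<le> ennreal ((t / 2 ^ s / t) powr (\<gamma> / 2)) * kernel (norm (x - y)) (t / 2 ^ s)"
        using t by (intro kernel_decay) (auto simp: divide_le_eq mult_le_cancel_left1)
      also have "(t / 2 ^ s / t) powr (\<gamma> / 2) = (1 / growth) ^ s * (1 / growth) ^ s"
        using t by (rule growth_gain)
      finally have "?F s y \<le> ennreal (growth ^ s) * (g y * (ennreal ((1 / growth) ^ s * (1 / growth) ^ s) *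
          kernel (norm (x - y)) (t / 2 ^ s)) * of_bool (potential x (norm (x - y)) (t / 2 ^ s) \<le> e))"
        by (intro mult_left_mono mult_right_mono) auto
      also have "\<dots> = ennreal ?q * (g y * kernel (norm (x - y)) (t / 2 ^ s) *
        of_bool (potential x (norm (x - y)) (t / 2 ^ s) \<le> e))"
        using growth_gt_1 by (subst ennreal_mult) (auto simp: mult_ac)
      finally show "?F s y \<le> ennreal ?q * (g y * kernel (norm (x - y)) (t / 2 ^ s) *
        of_bool (potential x (norm (x - y)) (t / 2 ^ s) \<le> e))" .
    qed
    also have "\<dots> = ennreal ?q * (\<integral>\<^sup>+y. g y * kernel (norm (x - y)) (t / 2 ^ s) *
        of_bool (potential x (norm (x - y)) (t / 2 ^ s) \<le> e) \<partial>lborel)"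
      by (intro nn_integral_cmult) measurable
    also have "\<dots> \<le> ennreal ?q * e"
      using t by (intro mult_left_mono nn_integral_below_level) auto
    also have "?q = (1 / growth) ^ s"
      using growth_gt_1 by (simp add: power_divide)
    finally show ?thesis .
  qed
  then have "(\<Sum>s. \<integral>\<^sup>+y. ?F s y \<partial>lborel) \<le> (\<Sum>s. ennreal ((1 / growth) ^ s) * e)"
    by (intro suminf_le) auto
  also have "\<dots> = ennreal bounded_const * e"
    unfolding bounded_const_def using growth_gt_1
    by (subst ennreal_suminf_multc, subst suminf_ennreal_geometric) simp_all
  finally show ?thesis
    by (subst nn_integral_suminf) auto
qed

text \<open>
  The level \<open>e\<close> is chosen so that the layers with moderate weight contribute at most \<open>l / 2\<close> off the
  exceptional set.  Wherever the average exceeds \<open>l\<close>, the layers with large weight then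
  account for at least \<open>l / 2\<close>, and they are estimated by charging.
\<close>
lemma weak_type_rough:
  fixes W :: "'a \<Rightarrow> real" and \<phi> :: "real \<Rightarrow> ennreal"
  assumes fin: "\<And>x t. 0 < t \<Longrightarrow> potential x 0 t < \<infinity>"
    and [measurable]: "\<phi> \<in> borel_measurable borel" "W \<in> borel_measurable borel"
    and le: "\<And>r. 0 \<le> r \<Longrightarrow> \<phi> r \<le> \<Phi> r"
    and hom: "\<And>t z. 0 < t \<Longrightarrow> W (t *\<^sub>R z) = W z"
    and l: "0 < l"
  shows "ennreal l * halfspace_integral \<gamma> (\<lambda>x t. of_bool (ennreal l < (\<integral>\<^sup>+y. g y *
      (ennreal (t powr - (DIM('a) + \<gamma>)) * (ennreal (W (x - y)) * \<phi> (norm (x - y) / t))) \<partial>lborel)))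
    \<le> ennreal (2 * bounded_const * exceptional_const) *
        ((\<integral>\<^sup>+y. g y \<partial>lborel) * (\<integral>\<^sup>+w. \<Phi> (norm (w::'a)) \<partial>lborel)) +
      ennreal (4 * ln (2 * dilation ^ 2)) * ((\<integral>\<^sup>+y. g y \<partial>lborel) *
        (\<Sum>s. \<integral>\<^sup>+w. ennreal (W w) * of_bool (growth ^ s < W w) * \<phi> (norm w) \<partial>lborel))"
proof -
  define e where "e = ennreal (l / (2 * bounded_const))"
  define R where "R x t y = g y * (ennreal (t powr - (DIM('a) + \<gamma>)) *
      (ennreal (W (x - y)) * \<phi> (norm (x - y) / t)))" for x y :: 'a and t
  define H where "H s w = ennreal (W w) * of_bool (growth ^ s < W w) * \<phi> (norm w)" for s w
  define F where "F s x t y = g y * (ennreal (t powr - (DIM('a) + \<gamma>)) * H s ((x - y) /\<^sub>R t)) *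
      of_bool (potential y (norm (x - y)) (dilation / 2 ^ s * t) \<le> e \<and>
        e < potential y (norm (x - y)) (1 / (2 ^ Suc s * dilation) * t))" for s x y and t
  have [measurable]: "H s \<in> borel_measurable borel" for s
    unfolding H_def by measurable
  have [measurable]: "(\<lambda>z. R (x z) (t z) (y z)) \<in> borel_measurable M"
    if [measurable]: "x \<in> borel_measurable M" "t \<in> borel_measurable M" "y \<in> borel_measurable M"
    for x y t and M :: "'b measure"
    unfolding R_def by measurable
  have [measurable]: "(\<lambda>z. F s (x z) (t z) (y z)) \<in> borel_measurable M"
    if [measurable]: "x \<in> borel_measurable M" "t \<in> borel_measurable M" "y \<in> borel_measurable M"
    for x y t s and M :: "'b measure"
    unfolding F_def by measurable
  have A: "1 \<le> dilation" by (rule dilation_ge_1)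
  let ?M = "\<lambda>s x t y. ennreal (growth ^ s) * (g y * kernel (norm (x - y)) t *
      of_bool (potential x (norm (x - y)) (t / 2 ^ s) \<le> e))"
  \<comment> \<open>Layer \<open>s\<close> consists of the \<open>y\<close> with crossing time between \<open>t / 2 ^ Suc s\<close> and \<open>t / 2 ^ s\<close>, seen from \<open>x\<close>. In \<open>F\<close> the crossing time is seen from \<open>y\<close>, as charging requires.\<close>
  have split: "R x t y \<le> (\<Sum>s. ?M s x t y) + (\<Sum>s. F s x t y)"
    if t: "0 < t" and small: "potential x 0 t \<le> e" for x y t
  proof -
    let ?r = "norm (x - y)"
    let ?P = "\<lambda>s. potential x ?r (t / 2 ^ s) \<le> e"
    have moderate: "R x t y \<le> (\<Sum>s. ?M s x t y) + (\<Sum>s. F s x t y)"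
      if "?P s" "W (x - y) \<le> growth ^ s" for s
    proof -
      have "R x t y \<le> g y * (ennreal (t powr - (DIM('a) + \<gamma>)) * (ennreal (growth ^ s) * \<Phi> (?r / t)))"
        unfolding R_def using that t by (intro mult_left_mono mult_mono le ennreal_leI) auto
      also have "\<dots> = ?M s x t y"
        using that by (simp add: kernel_def mult_ac)
      also have "\<dots> \<le> (\<Sum>s. ?M s x t y)"
        using sum_le_suminf[of "\<lambda>s. ?M s x t y" "{s}"] by simp
      finally show ?thesis
        by (rule order_trans) simp
    qed
    show ?thesis
    proof (cases "\<exists>s. ?P s \<and> \<not> ?P (Suc s)")
      case True
      then obtain s where s: "?P s" "\<not> ?P (Suc s)" by blast
      show ?thesis
      proof (cases "W (x - y) \<le> growth ^ s")
        case False
        have "potential y ?r (dilation / 2 ^ s * t) \<le> potential x ?r (dilation / 2 ^ s * t / dilation)"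
          using t A by (intro potential_shift) (auto simp: norm_minus_commute)
        then have 1: "potential y ?r (dilation / 2 ^ s * t) \<le> e"
          using s A by (auto intro: order_trans)
        have "e < potential x ?r (t / 2 ^ Suc s)"
          using s by simp
        also have "\<dots> \<le> potential y ?r (t / 2 ^ Suc s / dilation)"
          using t by (intro potential_shift) auto
        finally have 2: "e < potential y ?r (1 / (2 ^ Suc s * dilation) * t)"
          by (simp add: mult_ac)
        have "W ((x - y) /\<^sub>R t) = W (x - y)" "norm ((x - y) /\<^sub>R t) = ?r / t"
          using t by (simp_all add: hom divide_inverse mult.commute)
        then have "R x t y = F s x t y"
          using False 1 2 unfolding R_def F_def H_def by simp
        also have "\<dots> \<le> (\<Sum>s. F s x t y)"
          using sum_le_suminf[of "\<lambda>s. F s x t y" "{s}"] by simp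
        finally show ?thesis
          by (rule order_trans) simp
      qed (use s moderate in blast)
    next
      case False
      have "?P 0"
        using small potential_antimono_radius[OF t, of 0 ?r x] by simp
      then have all: "?P s" for s
        by (induction s) (use False in auto)
      \<comment> \<open>The potential stays below \<open>e\<close> at all small times, so \<open>s\<close> is free and can be taken large enough for the weight to count as moderate.\<close>
      obtain s where "W (x - y) < growth ^ s"
        using real_arch_pow[OF growth_gt_1] by blast
      then show ?thesis
        by (intro moderate[of s] all less_imp_le)
    qed
  qed
  have pointwise: "ennreal l * of_bool (ennreal l < (\<integral>\<^sup>+y. R x t y \<partial>lborel)) \<le>
      ennreal l * of_bool (e < potential x 0 t) + 2 * (\<Sum>s. \<integral>\<^sup>+y. F s x t y \<partial>lborel)"
    if t: "0 < t" for x t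
  proof (cases "potential x 0 t \<le> e \<and> ennreal l < (\<integral>\<^sup>+y. R x t y \<partial>lborel)")
    case True
    then have "ennreal l \<le> (\<integral>\<^sup>+y. R x t y \<partial>lborel)"
      using less_imp_le by blast
    also have "\<dots> \<le> (\<integral>\<^sup>+y. (\<Sum>s. ?M s x t y) + (\<Sum>s. F s x t y) \<partial>lborel)"
      using True t by (intro nn_integral_mono split) auto
    also have "\<dots> = (\<integral>\<^sup>+y. (\<Sum>s. ?M s x t y) \<partial>lborel) + (\<integral>\<^sup>+y. (\<Sum>s. F s x t y) \<partial>lborel)"
      by (intro nn_integral_add) measurable
    also have "(\<integral>\<^sup>+y. (\<Sum>s. F s x t y) \<partial>lborel) = (\<Sum>s. \<integral>\<^sup>+y. F s x t y \<partial>lborel)"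
      by (intro nn_integral_suminf) measurable
    also have "(\<integral>\<^sup>+y. (\<Sum>s. ?M s x t y) \<partial>lborel) \<le> ennreal bounded_const * e"
      by (rule moderate_part_bound[OF t])
    finally have "2 * ennreal l \<le> 2 * (ennreal bounded_const * e + (\<Sum>s. \<integral>\<^sup>+y. F s x t y \<partial>lborel))"
      by (intro mult_left_mono) (auto intro: add_right_mono)
    also have "\<dots> = 2 * ennreal bounded_const * e + 2 * (\<Sum>s. \<integral>\<^sup>+y. F s x t y \<partial>lborel)"
      by (simp add: distrib_left mult.assoc)
    also have "2 * ennreal bounded_const * e = ennreal l"
    proof -
      have "2 * ennreal bounded_const * e = ennreal (2 * bounded_const * (l / (2 * bounded_const)))"
        unfolding e_def using bounded_const_pos l by (subst ennreal_mult) (auto simp: ennreal_mult)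
      then show ?thesis using bounded_const_pos by simp
    qed
    finally have "ennreal l + ennreal l \<le> ennreal l + 2 * (\<Sum>s. \<integral>\<^sup>+y. F s x t y \<partial>lborel)"
      by (simp only: mult_2)
    then have "ennreal l \<le> 2 * (\<Sum>s. \<integral>\<^sup>+y. F s x t y \<partial>lborel)"
      by (auto simp: ennreal_add_left_cancel_le)
    then show ?thesis
      using True by simp
  qed auto
  have charge: "halfspace_integral \<gamma> (\<lambda>x t. \<integral>\<^sup>+y. F s x t y \<partial>lborel) \<le>
      ennreal (2 * ln (2 * dilation ^ 2)) * ((\<integral>\<^sup>+y. g y \<partial>lborel) * (\<integral>\<^sup>+w. H s w \<partial>lborel))" for s
  proof -
    have ratio: "dilation / 2 ^ s / (1 / (2 ^ Suc s * dilation)) = 2 * dilation ^ 2"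
      by (simp add: power2_eq_square)
    have "1 / (2 ^ Suc s * dilation) \<le> 1 / 2 ^ s"
      using A by (intro divide_left_mono) (auto simp: mult_ac intro!: mult_ge1_I)
    also have "\<dots> \<le> dilation / 2 ^ s"
      using A by (intro divide_right_mono) auto
    finally have "1 / (2 ^ Suc s * dilation) \<le> dilation / 2 ^ s" .
    then have "halfspace_integral \<gamma> (\<lambda>x t. \<integral>\<^sup>+y. F s x t y \<partial>lborel) \<le>
        ennreal (2 * ln (dilation / 2 ^ s / (1 / (2 ^ Suc s * dilation)))) *
        ((\<integral>\<^sup>+y. g y \<partial>lborel) * (\<integral>\<^sup>+w. H s w \<partial>lborel))"
      unfolding F_def using A by (intro charging) auto
    then show ?thesis
      by (simp only: ratio)
  qed
  let ?E = "halfspace_integral \<gamma> (\<lambda>x t. of_bool (e < potential x 0 t))"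
  have "ennreal l * halfspace_integral \<gamma> (\<lambda>x t. of_bool (ennreal l < (\<integral>\<^sup>+y. R x t y \<partial>lborel)))
      = halfspace_integral \<gamma> (\<lambda>x t. ennreal l * of_bool (ennreal l < (\<integral>\<^sup>+y. R x t y \<partial>lborel)))"
    by (intro halfspace_integral_cmult[symmetric]) measurable
  also have "\<dots> \<le> halfspace_integral \<gamma> (\<lambda>x t. ennreal l * of_bool (e < potential x 0 t) +
      2 * (\<Sum>s. \<integral>\<^sup>+y. F s x t y \<partial>lborel))"
    by (intro halfspace_integral_mono pointwise)
  also have "\<dots> = halfspace_integral \<gamma> (\<lambda>x t. ennreal l * of_bool (e < potential x 0 t)) +
      halfspace_integral \<gamma> (\<lambda>x t. 2 * (\<Sum>s. \<integral>\<^sup>+y. F s x t y \<partial>lborel))"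
    by (intro halfspace_integral_add) measurable
  also have "halfspace_integral \<gamma> (\<lambda>x t. ennreal l * of_bool (e < potential x 0 t)) = ennreal l * ?E"
    by (intro halfspace_integral_cmult) measurable
  also have "halfspace_integral \<gamma> (\<lambda>x t. 2 * (\<Sum>s. \<integral>\<^sup>+y. F s x t y \<partial>lborel)) =
      2 * (\<Sum>s. halfspace_integral \<gamma> (\<lambda>x t. \<integral>\<^sup>+y. F s x t y \<partial>lborel))"
    by (subst halfspace_integral_cmult, measurable, subst halfspace_integral_suminf, measurable)
  also have "ennreal l * ?E = ennreal (2 * bounded_const) * (e * ?E)"
  proof -
    have "ennreal (2 * bounded_const) * e = ennreal l"
      unfolding e_def using bounded_const_pos l by (subst ennreal_mult[symmetric]) auto
    then show ?thesis
      by (simp only: mult.assoc[symmetric])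
  qed
  also have "ennreal (2 * bounded_const) * (e * ?E) \<le> ennreal (2 * bounded_const) * (ennreal exceptional_const *
      ((\<integral>\<^sup>+y. g y \<partial>lborel) * (\<integral>\<^sup>+w. \<Phi> (norm (w::'a)) \<partial>lborel)))"
    unfolding e_def using fin l bounded_const_pos by (intro mult_left_mono exceptional_set_bound) auto
  also have "2 * (\<Sum>s. halfspace_integral \<gamma> (\<lambda>x t. \<integral>\<^sup>+y. F s x t y \<partial>lborel)) \<le>
      2 * (\<Sum>s. ennreal (2 * ln (2 * dilation ^ 2)) * ((\<integral>\<^sup>+y. g y \<partial>lborel) * (\<integral>\<^sup>+w. H s w \<partial>lborel)))"
    by (intro mult_left_mono suminf_le charge) auto
  also have "\<dots> = ennreal (4 * ln (2 * dilation ^ 2)) * ((\<integral>\<^sup>+y. g y \<partial>lborel) * (\<Sum>s. \<integral>\<^sup>+w. H s w \<partial>lborel))"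
  proof -
    have "(0::real) \<le> 2 * ln (2 * dilation ^ 2)"
      using one_le_power[OF A, of 2] by (intro mult_nonneg_nonneg ln_ge_zero) linarith+
    then have "ennreal (4 * ln (2 * dilation ^ 2)) = 2 * ennreal (2 * ln (2 * dilation ^ 2))"
      using ennreal_mult[of 2 "2 * ln (2 * dilation ^ 2)"] by simp
    then show ?thesis
      by (simp only: ennreal_suminf_cmult mult.assoc)
  qed
  finally show ?thesis
    unfolding R_def H_def using bounded_const_pos exceptional_const_nonneg
    by (simp add: ennreal_mult' add_mono mult.assoc)
qed

end

section \<open>Doubling majorants of decreasing profiles\<close>

text \<open>
  The least majorant of \<open>\<phi>\<close> for which \<open>r powr m\<close> times it is nondecreasing on \<open>r \<ge> 0\<close>.
\<close>
definition tail_majorant :: "real \<Rightarrow> (real \<Rightarrow> ennreal) \<Rightarrow> real \<Rightarrow> ennreal" where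
  "tail_majorant m \<phi> r = (SUP \<kappa>\<in>{1..}. ennreal (\<kappa> powr - m) * \<phi> (r / \<kappa>))"

lemma antimono_tail_majorant:
  assumes "antimono \<phi>"
  shows "antimono (tail_majorant m \<phi>)"
proof (rule antimonoI)
  fix r r' :: real assume "r \<le> r'"
  then show "tail_majorant m \<phi> r' \<le> tail_majorant m \<phi> r"
    unfolding tail_majorant_def
  proof (intro SUP_least)
    fix \<kappa> :: real assume "\<kappa> \<in> {1..}"
    with \<open>r \<le> r'\<close> show "ennreal (\<kappa> powr - m) * \<phi> (r' / \<kappa>) \<le> (SUP \<kappa>\<in>{1..}. ennreal (\<kappa> powr - m) * \<phi> (r / \<kappa>))"
      by (intro SUP_upper2[of \<kappa>] mult_left_mono antimonoD[OF assms] divide_right_mono) auto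
  qed
qed

lemma tail_majorant_ge: "\<phi> r \<le> tail_majorant m \<phi> r"
  unfolding tail_majorant_def by (rule SUP_upper2[of 1]) auto

lemma tail_majorant_doubling:
  assumes "1 \<le> \<kappa>"
  shows "tail_majorant m \<phi> r \<le> ennreal (\<kappa> powr m) * tail_majorant m \<phi> (\<kappa> * r)"
  unfolding tail_majorant_def[of m \<phi> r]
proof (rule SUP_least)
  fix c :: real assume c: "c \<in> {1..}"
  have "ennreal ((\<kappa> * c) powr - m) * \<phi> (\<kappa> * r / (\<kappa> * c)) \<le> tail_majorant m \<phi> (\<kappa> * r)"
    unfolding tail_majorant_def using c assms by (intro SUP_upper) (auto intro: mult_ge1_I)
  then have "ennreal (\<kappa> powr m) * (ennreal ((\<kappa> * c) powr - m) * \<phi> (r / c))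
      \<le> ennreal (\<kappa> powr m) * tail_majorant m \<phi> (\<kappa> * r)"
    using assms by (intro mult_left_mono) auto
  moreover have "\<kappa> powr m * (\<kappa> * c) powr - m = c powr - m"
    using c assms by (simp add: powr_mult powr_minus)
  ultimately show "ennreal (c powr - m) * \<phi> (r / c) \<le> ennreal (\<kappa> powr m) * tail_majorant m \<phi> (\<kappa> * r)"
    by (simp add: ennreal_mult'[symmetric] mult.assoc[symmetric])
qed

lemma tail_majorant_le_at_0:
  assumes "antimono \<phi>" "0 \<le> m" "0 \<le> r"
  shows "tail_majorant m \<phi> r \<le> \<phi> 0"
  unfolding tail_majorant_def
proof (rule SUP_least)
  fix c :: real assume c: "c \<in> {1..}"
  have "ennreal (c powr - m) * \<phi> (r / c) \<le> 1 * \<phi> 0"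
    using assms c by (intro mult_mono antimonoD[OF assms(1)])
      (auto simp: powr_minus inverse_eq_divide divide_le_eq ge_one_powr_ge_zero)
  then show "ennreal (c powr - m) * \<phi> (r / c) \<le> \<phi> 0" by simp
qed

text \<open>
  Splitting the supremum over \<open>\<kappa>\<close> into dyadic ranges, and bounding each range by its endpoints, turns
  it into a sum whose integral can be computed term by term.
\<close>
lemma tail_majorant_le_suminf:
  assumes "antimono \<phi>" "0 \<le> m" "0 \<le> r"
  shows "tail_majorant m \<phi> r \<le> (\<Sum>i. ennreal ((2 powr - m) ^ i) * \<phi> (r / 2 ^ Suc i))"
  unfolding tail_majorant_def
proof (rule SUP_least)
  fix c :: real assume "c \<in> {1..}"
  then have c: "1 \<le> c" by simp
  obtain j where j: "c < 2 ^ j"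
    using real_arch_pow[of 2 c] by auto
  define k where "k = (LEAST j. c < 2 ^ j)"
  have k: "c < 2 ^ k"
    unfolding k_def using j by (rule LeastI)
  with c have "k \<noteq> 0" by (auto intro!: Nat.gr0I)
  then obtain i where i: "k = Suc i" by (cases k) auto
  then have lo: "2 ^ i \<le> c"
    using not_less_Least[of i "\<lambda>j. c < 2 ^ j"] by (simp add: k_def)
  have "ennreal (c powr - m) * \<phi> (r / c) \<le> ennreal ((2 powr - m) ^ i) * \<phi> (r / 2 ^ Suc i)"
  proof (intro mult_mono ennreal_leI antimonoD[OF assms(1)])
    have "c powr - m \<le> (2 ^ i) powr - m"
      using lo assms by (intro powr_mono2') auto
    then show "c powr - m \<le> (2 powr - m) ^ i"
      by (simp add: two_power_powr)
    show "r / 2 ^ Suc i \<le> r / c"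
      using k i c assms by (intro divide_left_mono) auto
  qed auto
  also have "\<dots> \<le> (\<Sum>i. ennreal ((2 powr - m) ^ i) * \<phi> (r / 2 ^ Suc i))"
    using sum_le_suminf[of "\<lambda>i. ennreal ((2 powr - m) ^ i) * \<phi> (r / 2 ^ Suc i)" "{i}"] by simp
  finally show "ennreal (c powr - m) * \<phi> (r / c) \<le> (\<Sum>i. ennreal ((2 powr - m) ^ i) * \<phi> (r / 2 ^ Suc i))" .
qed

lemma nn_integral_radial_dilate:
  assumes [measurable]: "\<phi> \<in> borel_measurable borel" and c: "0 < c"
  shows "(\<integral>\<^sup>+w. \<phi> (norm (w::'a::euclidean_space) / c) \<partial>lborel) =
    ennreal (c ^ DIM('a)) * (\<integral>\<^sup>+w. \<phi> (norm (w::'a)) \<partial>lborel)"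
  using c by (subst nn_integral_affine[where c = c and a = 0]) auto

text \<open>
  The \<open>i\<close>-th term of the dyadic sum has the weight \<open>2^-(n + \<gamma>/2) i\<close>, while dilating by \<open>2^(i + 1)\<close>
  multiplies the integral by \<open>2^(i + 1) n\<close>.  The excess \<open>\<gamma>/2\<close> makes the series converge.
\<close>
lemma nn_integral_tail_majorant:
  assumes \<gamma>: "0 < \<gamma>" and \<phi>: "antimono \<phi>"
  shows "(\<integral>\<^sup>+w. tail_majorant (DIM('a) + \<gamma> / 2) \<phi> (norm (w::'a::euclidean_space)) \<partial>lborel)
    \<le> ennreal (2 ^ DIM('a) / (1 - 2 powr - (\<gamma> / 2))) * (\<integral>\<^sup>+w. \<phi> (norm (w::'a)) \<partial>lborel)"
proof -
  let ?m = "DIM('a) + \<gamma> / 2"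
  note [measurable] = borel_measurable_antimono_ennreal[OF \<phi>]
  have "(\<integral>\<^sup>+w. tail_majorant ?m \<phi> (norm (w::'a)) \<partial>lborel)
      \<le> (\<integral>\<^sup>+w. (\<Sum>i. ennreal ((2 powr - ?m) ^ i) * \<phi> (norm (w::'a) / 2 ^ Suc i)) \<partial>lborel)"
    using \<gamma> \<phi> by (intro nn_integral_mono tail_majorant_le_suminf) auto
  also have "\<dots> = (\<Sum>i. ennreal ((2 powr - ?m) ^ i) * (\<integral>\<^sup>+w. \<phi> (norm (w::'a) / 2 ^ Suc i) \<partial>lborel))"
    by (simp add: nn_integral_suminf nn_integral_cmult del: power_Suc)
  also have "\<dots> = (\<Sum>i. ennreal (2 ^ DIM('a)) * ennreal ((2 powr - (\<gamma> / 2)) ^ i) * (\<integral>\<^sup>+w. \<phi> (norm (w::'a)) \<partial>lborel))"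
  proof (intro suminf_cong)
    fix i
    have "2 powr - ?m * 2 ^ DIM('a) = 2 powr - (\<gamma> / 2)"
      by (simp add: powr_realpow[symmetric] powr_add[symmetric] del: powr_realpow)
    then have "(2 powr - ?m) ^ i * (2 ^ Suc i) ^ DIM('a) = 2 ^ DIM('a) * (2 powr - (\<gamma> / 2)) ^ i"
      by (simp add: power_mult_distrib power_commutes flip: power_mult power_mult_distrib)
        (metis (no_types, lifting) mult.commute mult.left_commute power_mult power_mult_distrib)
    then show "ennreal ((2 powr - ?m) ^ i) * (\<integral>\<^sup>+w. \<phi> (norm (w::'a) / 2 ^ Suc i) \<partial>lborel) =
        ennreal (2 ^ DIM('a)) * ennreal ((2 powr - (\<gamma> / 2)) ^ i) * (\<integral>\<^sup>+w. \<phi> (norm (w::'a)) \<partial>lborel)"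
      by (subst nn_integral_radial_dilate)
         (simp_all add: ennreal_mult'[symmetric] mult.assoc[symmetric] del: power_Suc)
  qed
  also have "\<dots> = ennreal (2 ^ DIM('a)) * ennreal (1 / (1 - 2 powr - (\<gamma> / 2))) * (\<integral>\<^sup>+w. \<phi> (norm (w::'a)) \<partial>lborel)"
    using \<gamma> by (subst ennreal_suminf_multc, subst ennreal_suminf_cmult, subst suminf_ennreal_geometric)
      (simp_all add: powr_less_one)
  also have "ennreal (2 ^ DIM('a)) * ennreal (1 / (1 - 2 powr - (\<gamma> / 2))) = ennreal (2 ^ DIM('a) / (1 - 2 powr - (\<gamma> / 2)))"
    by (simp flip: ennreal_mult')
  finally show ?thesis .
qed

section \<open>The weak type bound for homogeneous weights\<close>

text \<open>
  This is where the logarithm comes from: \<open>u\<close> exceeds about \<open>ln u / ln q\<close> powers of \<open>q\<close>.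
\<close>
lemma suminf_exceeded_powers_le:
  fixes u :: real
  assumes q: "1 < q" and u: "0 \<le> u"
  shows "(\<Sum>s. of_bool (q ^ s < u)) \<le> ennreal ((1 + 1 / ln q) * (1 + log_plus u))"
proof (cases "1 < u")
  case False
  have "\<not> q ^ s < u" for s
    using False q one_le_power[of q s] by linarith
  then show ?thesis by simp
next
  case True
  define k where "k = nat \<lceil>ln u / ln q\<rceil>"
  have k: "s < k" if "q ^ s < u" for s
  proof -
    have "ln (q ^ s) < ln u"
      using that q True by (subst ln_less_cancel_iff) auto
    then have "real s < ln u / ln q"
      using q by (simp add: ln_realpow pos_less_divide_eq)
    then show ?thesis
      unfolding k_def by linarith
  qed
  have "(\<Sum>s. of_bool (q ^ s < u)) = (\<Sum>s<k. of_bool (q ^ s < u) :: ennreal)"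
    using k by (intro suminf_finite) auto
  also have "\<dots> \<le> (\<Sum>s<k. 1)"
    by (intro sum_mono) auto
  also have "\<dots> = ennreal (real k)"
    by (simp add: ennreal_of_nat_eq_real_of_nat)
  also have "\<dots> \<le> ennreal ((1 + 1 / ln q) * (1 + log_plus u))"
  proof (rule ennreal_leI)
    have pos: "0 < ln q" "0 < ln u" using q True by auto
    then have "0 \<le> ln u / ln q" by simp
    then have "real k \<le> ln u / ln q + 1"
      unfolding k_def by linarith
    also have "\<dots> \<le> (1 + 1 / ln q) * (1 + ln u)"
      using pos by (simp add: field_simps)
    also have "ln u = log_plus u"
      using pos by (simp add: log_plus_def)
    finally show "real k \<le> (1 + 1 / ln q) * (1 + log_plus u)" .
  qed
  finally show ?thesis .
qed

lemma log_plus_nonneg: "0 \<le> log_plus z"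
  by (simp add: log_plus_def)

lemma log_plus_measurable [measurable]: "log_plus \<in> borel_measurable borel"
  unfolding log_plus_def by measurable

text \<open>
  The summands come from the exceptional set (including the passage from \<open>\<phi>\<close> to its majorant) and from
  the layers with large weight; the final \<open>1\<close> makes positivity evident.
\<close>
definition weak_type_const :: "'a::euclidean_space itself \<Rightarrow> real \<Rightarrow> real" where
  "weak_type_const T \<gamma> =
     2 * doubling_kernel.bounded_const \<gamma> * doubling_kernel.exceptional_const T \<gamma> *
       (2 ^ DIM('a) / (1 - 2 powr - (\<gamma> / 2))) +
     4 * ln (2 * doubling_kernel.dilation T \<gamma> ^ 2) * (1 + 1 / ln (doubling_kernel.growth \<gamma>)) + 1"

text \<open>
  Signs of the constants, which depend on \<open>\<gamma>\<close> and the dimension only and can therefore be read off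
  from the trivial kernel.
\<close>
lemma weak_type_const_summands:
  fixes \<gamma> :: real
  assumes \<gamma>: "0 < \<gamma>"
  shows "0 \<le> 2 * doubling_kernel.bounded_const \<gamma> * doubling_kernel.exceptional_const TYPE('a::euclidean_space) \<gamma>"
    and "0 \<le> 4 * ln (2 * doubling_kernel.dilation TYPE('a) \<gamma> ^ 2)"
    and "1 < doubling_kernel.growth \<gamma>"
proof -
  interpret zero: doubling_kernel \<gamma> "\<lambda>_. 0" "\<lambda>_::'a. 0"
    using \<gamma> by unfold_locales (auto intro!: antimonoI)
  show "0 \<le> 2 * zero.bounded_const * zero.exceptional_const"
    using zero.bounded_const_pos zero.exceptional_const_nonneg by simp
  show "0 \<le> 4 * ln (2 * zero.dilation ^ 2)"
    using one_le_power[OF zero.dilation_ge_1, of 2]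
    by (intro mult_nonneg_nonneg ln_ge_zero) linarith+
  show "1 < zero.growth"
    by (rule zero.growth_gt_1)
qed

lemma weak_type_const_pos:
  assumes \<gamma>: "0 < \<gamma>"
  shows "0 < weak_type_const TYPE('a::euclidean_space) \<gamma>"
proof -
  have 1: "0 \<le> 2 ^ DIM('a) / (1 - 2 powr - (\<gamma> / 2))"
    using \<gamma> by (auto simp: powr_less_one less_imp_le intro!: divide_nonneg_nonneg)
  have 2: "0 \<le> 1 + 1 / ln (doubling_kernel.growth \<gamma>)"
    using weak_type_const_summands(3)[OF \<gamma>] by simp
  show ?thesis
    using mult_nonneg_nonneg[OF weak_type_const_summands(1)[OF \<gamma>, where 'a='a] 1]
      mult_nonneg_nonneg[OF weak_type_const_summands(2)[OF \<gamma>, where 'a='a] 2]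
    unfolding weak_type_const_def by linarith
qed

text \<open>
  Finiteness of \<open>\<phi> 0\<close> makes the majorant bounded, and with \<open>g\<close> integrable all potentials are finite; so
  \<open>weak_type_rough\<close> applies to the majorant.
\<close>
lemma weak_type_homogeneous:
  fixes \<gamma> :: real and \<phi> :: "real \<Rightarrow> ennreal" and W :: "'a::euclidean_space \<Rightarrow> real" and g :: "'a \<Rightarrow> ennreal"
  assumes \<gamma>: "0 < \<gamma>" and \<phi>: "antimono \<phi>" and \<phi>0: "\<phi> 0 < \<infinity>"
    and W [measurable]: "W \<in> borel_measurable borel" and W0: "\<And>z. 0 \<le> W z"
    and hom: "\<And>t z. 0 < t \<Longrightarrow> W (t *\<^sub>R z) = W z"
    and g [measurable]: "g \<in> borel_measurable borel" and gfin: "(\<integral>\<^sup>+y. g y \<partial>lborel) < \<infinity>"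
    and l: "0 < l"
  shows "ennreal l * halfspace_integral \<gamma> (\<lambda>x t. of_bool (ennreal l < (\<integral>\<^sup>+y. g y *
      (ennreal (t powr - (DIM('a) + \<gamma>)) * (ennreal (W (x - y)) * \<phi> (norm (x - y) / t))) \<partial>lborel)))
    \<le> ennreal (weak_type_const TYPE('a) \<gamma>) * ((\<integral>\<^sup>+y. g y \<partial>lborel) *
        (\<integral>\<^sup>+w. ennreal (1 + W w * (1 + log_plus (W w))) * \<phi> (norm w) \<partial>lborel))"
proof -
  note [measurable] = borel_measurable_antimono_ennreal[OF \<phi>]
  let ?m = "DIM('a) + \<gamma> / 2"
  let ?G = "\<integral>\<^sup>+y. g y \<partial>lborel"
  let ?Y = "\<integral>\<^sup>+w. ennreal (1 + W w * (1 + log_plus (W w))) * \<phi> (norm w) \<partial>lborel"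
  interpret doubling_kernel \<gamma> "tail_majorant ?m \<phi>" g
    using \<gamma> \<phi> g by unfold_locales (auto intro: antimono_tail_majorant tail_majorant_doubling)
  define a0 where "a0 = 2 * bounded_const * exceptional_const"
  define a where "a = a0 * (2 ^ DIM('a) / (1 - 2 powr - (\<gamma> / 2)))"
  define b0 where "b0 = 4 * ln (2 * dilation ^ 2)"
  define b where "b = b0 * (1 + 1 / ln growth)"
  have a0: "0 \<le> a0" and b0: "0 \<le> b0" and q: "1 < growth"
    unfolding a0_def b0_def using weak_type_const_summands(1,2)[OF \<gamma>, where 'a='a] weak_type_const_summands(3)[OF \<gamma>] by auto
  have a: "0 \<le> a"
    using a0 \<gamma> by (auto simp: a_def powr_less_one less_imp_le intro!: mult_nonneg_nonneg divide_nonneg_nonneg)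
  have b: "0 \<le> b"
    using b0 q by (auto simp: b_def)
  have fin: "potential x 0 t < \<infinity>" if "0 < t" for x t
  proof -
    have "potential x 0 t \<le> (\<integral>\<^sup>+y. g y * (ennreal (t powr - (DIM('a) + \<gamma>)) * \<phi> 0) \<partial>lborel)"
      unfolding potential_def kernel_def using that \<gamma> \<phi>
      by (intro nn_integral_mono mult_left_mono tail_majorant_le_at_0) auto
    also have "\<dots> = ?G * (ennreal (t powr - (DIM('a) + \<gamma>)) * \<phi> 0)"
      by (simp add: nn_integral_multc)
    also have "\<dots> < \<infinity>"
      using gfin \<phi>0 by (simp add: ennreal_mult_less_top)
    finally show ?thesis .
  qed
  have "ennreal l * halfspace_integral \<gamma> (\<lambda>x t. of_bool (ennreal l < (\<integral>\<^sup>+y. g y *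
    (ennreal (t powr - (DIM('a) + \<gamma>)) * (ennreal (W (x - y)) * \<phi> (norm (x - y) / t))) \<partial>lborel)))
    \<le> ennreal a0 * (?G * (\<integral>\<^sup>+w. tail_majorant ?m \<phi> (norm (w::'a)) \<partial>lborel)) +
      ennreal b0 * (?G * (\<Sum>s. \<integral>\<^sup>+w. ennreal (W w) * of_bool (growth ^ s < W w) * \<phi> (norm w) \<partial>lborel))"
    unfolding a0_def b0_def using hom l fin by (intro weak_type_rough tail_majorant_ge) auto
  also have "\<dots> \<le> ennreal a * (?G * ?Y) + ennreal b * (?G * ?Y)"
  proof (rule add_mono)
    have "(\<integral>\<^sup>+w. tail_majorant ?m \<phi> (norm (w::'a)) \<partial>lborel)
        \<le> ennreal (2 ^ DIM('a) / (1 - 2 powr - (\<gamma> / 2))) * (\<integral>\<^sup>+w. \<phi> (norm (w::'a)) \<partial>lborel)"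
      by (rule nn_integral_tail_majorant[OF \<gamma> \<phi>])
    also have "\<dots> \<le> ennreal (2 ^ DIM('a) / (1 - 2 powr - (\<gamma> / 2))) * ?Y"
    proof (intro mult_left_mono nn_integral_mono)
      fix w
      have "1 * \<phi> (norm w) \<le> ennreal (1 + W w * (1 + log_plus (W w))) * \<phi> (norm w)"
        using W0 log_plus_nonneg by (intro mult_right_mono) auto
      then show "\<phi> (norm w) \<le> ennreal (1 + W w * (1 + log_plus (W w))) * \<phi> (norm w)" by simp
    qed simp
    finally have "ennreal a0 * (?G * (\<integral>\<^sup>+w. tail_majorant ?m \<phi> (norm (w::'a)) \<partial>lborel)) \<le>
        ennreal a0 * (?G * (ennreal (2 ^ DIM('a) / (1 - 2 powr - (\<gamma> / 2))) * ?Y))"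
      by (auto intro!: mult_left_mono)
    also have "\<dots> = ennreal a * (?G * ?Y)"
      unfolding a_def by (subst ennreal_mult'[OF a0]) (simp only: mult_ac)
    finally show "ennreal a0 * (?G * (\<integral>\<^sup>+w. tail_majorant ?m \<phi> (norm (w::'a)) \<partial>lborel)) \<le> ennreal a * (?G * ?Y)" .
  next
    have "(\<Sum>s. \<integral>\<^sup>+w. ennreal (W w) * of_bool (growth ^ s < W w) * \<phi> (norm w) \<partial>lborel) =
        (\<integral>\<^sup>+w. ennreal (W w) * (\<Sum>s. of_bool (growth ^ s < W w)) * \<phi> (norm w) \<partial>lborel)"
      by (subst nn_integral_suminf[symmetric]) (simp_all add: mult.assoc)
    also have "\<dots> \<le> (\<integral>\<^sup>+w. ennreal (1 + 1 / ln growth) *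
        (ennreal (1 + W w * (1 + log_plus (W w))) * \<phi> (norm w)) \<partial>lborel)"
    proof (intro nn_integral_mono)
      fix w
      have "ennreal (W w) * (\<Sum>s. of_bool (growth ^ s < W w)) \<le>
          ennreal (W w) * ennreal ((1 + 1 / ln growth) * (1 + log_plus (W w)))"
        using W0 q by (intro mult_left_mono suminf_exceeded_powers_le) auto
      also have "\<dots> = ennreal ((1 + 1 / ln growth) * (W w * (1 + log_plus (W w))))"
        using W0 by (simp add: ennreal_mult'[symmetric] mult_ac)
      also have "\<dots> \<le> ennreal ((1 + 1 / ln growth) * (1 + W w * (1 + log_plus (W w))))"
        using q by (intro ennreal_leI mult_left_mono) auto
      also have "\<dots> = ennreal (1 + 1 / ln growth) * ennreal (1 + W w * (1 + log_plus (W w)))"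
        using q by (intro ennreal_mult') auto
      finally show "ennreal (W w) * (\<Sum>s. of_bool (growth ^ s < W w)) * \<phi> (norm w) \<le>
          ennreal (1 + 1 / ln growth) * (ennreal (1 + W w * (1 + log_plus (W w))) * \<phi> (norm w))"
        by (auto simp: mult.assoc[symmetric] intro: mult_right_mono)
    qed
    also have "\<dots> = ennreal (1 + 1 / ln growth) * ?Y"
      by (intro nn_integral_cmult) measurable
    finally have "ennreal b0 * (?G * (\<Sum>s. \<integral>\<^sup>+w. ennreal (W w) * of_bool (growth ^ s < W w) * \<phi> (norm w) \<partial>lborel))
        \<le> ennreal b0 * (?G * (ennreal (1 + 1 / ln growth) * ?Y))"
      by (auto intro!: mult_left_mono)
    also have "\<dots> = ennreal b * (?G * ?Y)"
      unfolding b_def by (subst ennreal_mult'[OF b0]) (simp only: mult_ac)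
    finally show "ennreal b0 * (?G * (\<Sum>s. \<integral>\<^sup>+w. ennreal (W w) * of_bool (growth ^ s < W w) * \<phi> (norm w) \<partial>lborel))
        \<le> ennreal b * (?G * ?Y)" .
  qed
  also have "\<dots> = ennreal (a + b) * (?G * ?Y)"
    using a b by (simp add: distrib_right[symmetric])
  also have "\<dots> \<le> ennreal (weak_type_const TYPE('a) \<gamma>) * (?G * ?Y)"
    by (intro mult_right_mono ennreal_leI) (auto simp: weak_type_const_def a_def a0_def b_def b0_def)
  finally show ?thesis .
qed

section \<open>From the averaging operator to nonnegative integrals\<close>

lemma AE_lborel_dilate:
  fixes P :: "'a::euclidean_space \<Rightarrow> bool"
  assumes P: "AE w in lborel. P w" and t: "0 < t"
  shows "AE y in lborel. P ((x - y) /\<^sub>R t)"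
proof -
  obtain N where N: "{w \<in> space lborel. \<not> P w} \<subseteq> N" "emeasure lborel N = 0" "N \<in> sets lborel"
    using AE_E[OF P] by blast
  have [measurable]: "N \<in> sets borel" using N by simp
  have "ennreal (\<bar>- 1 / t\<bar> ^ DIM('a)) * (\<integral>\<^sup>+y. indicator N (x /\<^sub>R t + (- 1 / t) *\<^sub>R y) \<partial>lborel) = (\<integral>\<^sup>+w. indicator N w \<partial>lborel)"
    using t by (intro nn_integral_affine[symmetric]) auto
  also have "\<dots> = 0"
    using N by simp
  finally have "(\<integral>\<^sup>+y. indicator N (x /\<^sub>R t + (- 1 / t) *\<^sub>R y) \<partial>lborel) = (0 :: ennreal)"
    using t by simp
  then have "AE y in lborel. indicator N (x /\<^sub>R t + (- 1 / t) *\<^sub>R y) = (0 :: ennreal)"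
    by (subst (asm) nn_integral_0_iff_AE) auto
  then show ?thesis
  proof eventually_elim
    case (elim y)
    have "x /\<^sub>R t + (- 1 / t) *\<^sub>R y = (x - y) /\<^sub>R t"
      by (simp add: scaleR_diff_right divide_inverse)
    with elim N(1) show ?case by (auto simp: indicator_def split: if_splits)
  qed
qed

text \<open>
  The Bochner integral in \<open>T_op\<close> is dominated by the integral of the absolute values whether or not the
  integrand is integrable, and Borel representatives \<open>g\<close> and \<open>H\<close> of \<open>|f|\<close> and \<open>|h|\<close> may be used there:
  for fixed \<open>x\<close> and \<open>t\<close> the map \<open>y \<mapsto> (x - y)/t\<close> pulls null sets back to null sets.
\<close>
lemma T_op_le_nn_integral:
  fixes f :: "'a::euclidean_space \<Rightarrow> complex" and \<gamma> :: real
  assumes t: "0 < t" and [measurable]: "g \<in> borel_measurable borel" "H \<in> borel_measurable borel"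
    and fg: "AE y in lborel. ennreal (norm (f y)) = g y"
    and h: "AE w in lborel. ennreal \<bar>h w\<bar> = H w"
  shows "ennreal (norm (T_op \<gamma> h f (x, t))) \<le>
    (\<integral>\<^sup>+y. g y * (ennreal (t powr - (DIM('a) + \<gamma>)) * H ((x - y) /\<^sub>R t)) \<partial>lborel)"
proof -
  let ?k = "\<lambda>y. f y * of_real (h ((x - y) /\<^sub>R t))"
  let ?c = "ennreal (t powr - (DIM('a) + \<gamma>))"
  have "ennreal (norm (T_op \<gamma> h f (x, t))) = ?c * ennreal (norm (\<integral>y. ?k y \<partial>lebesgue))"
    unfolding T_op_def by (simp add: norm_mult ennreal_mult')
  also have "\<dots> \<le> ?c * (\<integral>\<^sup>+y. ennreal (norm (?k y)) \<partial>lebesgue)"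
    using integral_norm_bound_ennreal[of lebesgue ?k]
    by (cases "integrable lebesgue ?k") (auto intro!: mult_left_mono simp: not_integrable_integral_eq)
  also have "(\<integral>\<^sup>+y. ennreal (norm (?k y)) \<partial>lebesgue) = (\<integral>\<^sup>+y. g y * H ((x - y) /\<^sub>R t) \<partial>lborel)"
    unfolding nn_integral_completion
  proof (intro nn_integral_cong_AE)
    show "AE y in lborel. ennreal (norm (?k y)) = g y * H ((x - y) /\<^sub>R t)"
      using fg AE_lborel_dilate[OF h t, of x]
      by eventually_elim (simp add: norm_mult ennreal_mult)
  qed
  also have "?c * (\<integral>\<^sup>+y. g y * H ((x - y) /\<^sub>R t) \<partial>lborel) = (\<integral>\<^sup>+y. ?c * (g y * H ((x - y) /\<^sub>R t)) \<partial>lborel)"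
    by (intro nn_integral_cmult[symmetric]) measurable
  finally show ?thesis by (simp add: mult_ac)
qed

text \<open>
  The set where \<open>|T_op \<gamma> h f|\<close> exceeds \<open>l\<close> is contained in the measurable set where the average of \<open>|f|\<close>
  exceeds \<open>l\<close>, and only this inclusion enters.
\<close>
lemma T_op_weak_type:
  fixes \<gamma> :: real and \<phi> :: "real \<Rightarrow> real" and W h :: "'a::euclidean_space \<Rightarrow> real" and f :: "'a \<Rightarrow> complex"
  assumes \<gamma>: "0 < \<gamma>" and \<phi>0: "\<forall>s\<ge>0. 0 \<le> \<phi> s" and \<phi>: "antimono_on {0..} \<phi>"
    and W [measurable]: "W \<in> borel_measurable borel" and W0: "\<And>z. 0 \<le> W z"
    and hom: "\<And>t z. 0 < t \<Longrightarrow> W (t *\<^sub>R z) = W z"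
    and h: "AE w in lborel. h w = W w * \<phi> (norm w)" and f: "integrable lebesgue f"
  shows "(SUP l\<in>{0<..}. ennreal l * emeasure (nu \<gamma>) {(x, t). 0 < t \<and> norm (T_op \<gamma> h f (x, t)) > l})
    \<le> ennreal (weak_type_const TYPE('a) \<gamma>) * (ennreal (\<integral>x. norm (f x) \<partial>lebesgue) *
        (\<integral>\<^sup>+w. ennreal (1 + W w * (1 + log_plus (W w))) * ennreal (\<phi> (norm w)) \<partial>lborel))"
proof (intro SUP_least)
  fix l :: real
  assume l: "l \<in> {0<..}"
  define \<psi> where "\<psi> r = ennreal (\<phi> (max 0 r))" for r
  have \<psi>: "antimono \<psi>"
    using \<phi> by (auto simp: \<psi>_def monotone_on_def intro!: ennreal_leI)
  note [measurable] = borel_measurable_antimono_ennreal[OF \<psi>]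
  have "(\<lambda>y. ennreal (norm (f y))) \<in> borel_measurable lebesgue"
    using f by measurable
  then obtain g where g [measurable]: "g \<in> borel_measurable lborel" and fg: "AE y in lborel. ennreal (norm (f y)) = g y"
    using completion_ex_borel_measurable by blast
  have "(\<integral>\<^sup>+y. g y \<partial>lborel) = (\<integral>\<^sup>+y. norm (f y) \<partial>lebesgue)"
    unfolding nn_integral_completion
    by (intro nn_integral_cong_AE) (use fg in eventually_elim, auto)
  also have "\<dots> = ennreal (\<integral>x. norm (f x) \<partial>lebesgue)"
    using f by (intro nn_integral_eq_integral) auto
  finally have int_g: "(\<integral>\<^sup>+y. g y \<partial>lborel) = ennreal (\<integral>x. norm (f x) \<partial>lebesgue)" .
  have fin: "(\<integral>\<^sup>+y. g y \<partial>lborel) < \<infinity>"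
    unfolding int_g by simp
  have H: "AE w in lborel. ennreal \<bar>h w\<bar> = ennreal (W w) * \<psi> (norm w)"
    using h
  proof eventually_elim
    case (elim w)
    then show ?case
      using W0 \<phi>0 by (simp add: \<psi>_def ennreal_mult' abs_mult)
  qed
  let ?P = "\<lambda>x t. ennreal l < (\<integral>\<^sup>+y. g y *
    (ennreal (t powr - (DIM('a) + \<gamma>)) * (ennreal (W (x - y)) * \<psi> (norm (x - y) / t))) \<partial>lborel)"
  have "emeasure (nu \<gamma>) {(x, t). 0 < t \<and> norm (T_op \<gamma> h f (x, t)) > l} \<le>
      emeasure (nu \<gamma>) {(x, t). 0 < t \<and> ?P x t}"
  proof (rule emeasure_mono)
    show "{(x, t). 0 < t \<and> norm (T_op \<gamma> h f (x, t)) > l} \<subseteq> {(x, t). 0 < t \<and> ?P x t}"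
    proof
      fix p assume "p \<in> {(x, t). 0 < t \<and> norm (T_op \<gamma> h f (x, t)) > l}"
      then obtain x t where p: "p = (x, t)" and t: "0 < t" and big: "l < norm (T_op \<gamma> h f (x, t))"
        by auto
      have "ennreal l < ennreal (norm (T_op \<gamma> h f (x, t)))"
        using big l by (intro ennreal_lessI) auto
      also have "\<dots> \<le> (\<integral>\<^sup>+y. g y * (ennreal (t powr - (DIM('a) + \<gamma>)) *
          (ennreal (W ((x - y) /\<^sub>R t)) * \<psi> (norm ((x - y) /\<^sub>R t)))) \<partial>lborel)"
        by (rule T_op_le_nn_integral[OF t _ _ fg H]; measurable)
      also have "\<dots> = (\<integral>\<^sup>+y. g y * (ennreal (t powr - (DIM('a) + \<gamma>)) *
          (ennreal (W (x - y)) * \<psi> (norm (x - y) / t))) \<partial>lborel)"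
        using t hom by (simp add: divide_inverse mult.commute)
      finally show "p \<in> {(x, t). 0 < t \<and> ?P x t}"
        using p t by simp
    qed
    show "{(x, t). 0 < t \<and> ?P x t} \<in> sets (nu \<gamma>)"
      by (intro sets_nu) measurable
  qed
  also have "\<dots> = halfspace_integral \<gamma> (\<lambda>x t. of_bool (?P x t))"
    by (intro emeasure_nu) measurable
  finally have "ennreal l * emeasure (nu \<gamma>) {(x, t). 0 < t \<and> norm (T_op \<gamma> h f (x, t)) > l} \<le>
      ennreal l * halfspace_integral \<gamma> (\<lambda>x t. of_bool (?P x t))"
    by (rule mult_left_mono) simp
  also have "\<dots> \<le> ennreal (weak_type_const TYPE('a) \<gamma>) * ((\<integral>\<^sup>+y. g y \<partial>lborel) *
      (\<integral>\<^sup>+w. ennreal (1 + W w * (1 + log_plus (W w))) * \<psi> (norm w) \<partial>lborel))"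
  proof (rule weak_type_homogeneous[OF \<gamma> \<psi> _ W W0 hom _ fin])
    show "\<psi> 0 < \<infinity>" by (simp add: \<psi>_def)
  qed (use l in auto)
  also have "\<dots> = ennreal (weak_type_const TYPE('a) \<gamma>) * (ennreal (\<integral>x. norm (f x) \<partial>lebesgue) *
      (\<integral>\<^sup>+w. ennreal (1 + W w * (1 + log_plus (W w))) * ennreal (\<phi> (norm w)) \<partial>lborel))"
    by (simp add: int_g \<psi>_def)
  finally show "ennreal l * emeasure (nu \<gamma>) {(x, t). 0 < t \<and> norm (T_op \<gamma> h f (x, t)) > l} \<le>
    ennreal (weak_type_const TYPE('a) \<gamma>) * (ennreal (\<integral>x. norm (f x) \<partial>lebesgue) *
      (\<integral>\<^sup>+w. ennreal (1 + W w * (1 + log_plus (W w))) * ennreal (\<phi> (norm w)) \<partial>lborel))" .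
qed

section \<open>Radial times angular integrals\<close>

lemma nn_integral_homogeneous_ball:
  fixes G :: "'a::euclidean_space \<Rightarrow> ennreal"
  assumes [measurable]: "G \<in> borel_measurable borel"
    and hom: "\<And>t z. 0 < t \<Longrightarrow> G (t *\<^sub>R z) = G z" and R: "0 < R"
  shows "(\<integral>\<^sup>+w. G w * indicator (ball 0 R) w \<partial>lborel) =
    ennreal (R ^ DIM('a)) * (\<integral>\<^sup>+w. G w * indicator (ball 0 1) w \<partial>lborel)"
proof -
  have "(\<integral>\<^sup>+w. G w * indicator (ball 0 R) w \<partial>lborel) =
      ennreal (\<bar>R\<bar> ^ DIM('a)) * (\<integral>\<^sup>+w. G (0 + R *\<^sub>R w) * indicator (ball 0 R) (0 + R *\<^sub>R w) \<partial>lborel)"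
    using R by (intro nn_integral_affine borel_measurable_times_ennreal borel_measurable_indicator) auto
  also have "(\<integral>\<^sup>+w. G (0 + R *\<^sub>R w) * indicator (ball 0 R) (0 + R *\<^sub>R w) \<partial>lborel) =
      (\<integral>\<^sup>+w. G w * indicator (ball 0 1) w \<partial>lborel)"
    using R by (intro nn_integral_cong) (auto simp: hom indicator_def)
  finally show ?thesis
    using R by simp
qed

text \<open>
  Since \<open>\<phi>\<close> decreases, its level set is a ball up to a sphere, and on balls the integral of a function
  that is homogeneous of degree \<open>0\<close> is proportional to the volume.  Finiteness excludes the whole space.
\<close>
lemma nn_integral_homogeneous_level_set:
  fixes G :: "'a::euclidean_space \<Rightarrow> ennreal" and \<phi> :: "real \<Rightarrow> real"
  assumes G: "G \<in> borel_measurable borel" and hom: "\<And>t z. 0 < t \<Longrightarrow> G (t *\<^sub>R z) = G z"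
    and \<phi>: "antimono \<phi>" and fin: "(\<integral>\<^sup>+w. of_bool (a < \<phi> (norm (w::'a))) \<partial>lborel) < \<infinity>"
  shows "emeasure lborel (ball (0::'a) 1) * (\<integral>\<^sup>+w. G w * of_bool (a < \<phi> (norm w)) \<partial>lborel) =
    (\<integral>\<^sup>+w. G w * indicator (ball 0 1) w \<partial>lborel) * (\<integral>\<^sup>+w. of_bool (a < \<phi> (norm (w::'a))) \<partial>lborel)"
proof -
  let ?S = "{r. 0 \<le> r \<and> a < \<phi> r}"
  have bdd: "bdd_above ?S"
  proof (rule ccontr)
    assume "\<not> bdd_above ?S"
    then have "a < \<phi> (norm w)" for w :: 'a
      using antimonoD[OF \<phi>, of "norm w"] unfolding bdd_above_def
      by (smt (verit) mem_Collect_eq order_less_le_trans)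
    then have "(\<integral>\<^sup>+w. of_bool (a < \<phi> (norm (w::'a))) \<partial>lborel) = \<infinity>"
      by simp
    with fin show False by simp
  qed
  define R where "R = (if ?S = {} then 0 else Sup ?S)"
  have inside: "a < \<phi> r" if "0 \<le> r" "r < R" for r
  proof -
    have "?S \<noteq> {}" "r < Sup ?S" using that by (auto simp: R_def split: if_splits)
    then obtain s where "s \<in> ?S" "r < s" using bdd by (auto simp: less_cSup_iff)
    then show ?thesis using antimonoD[OF \<phi>, of r s] by (auto intro: less_le_trans)
  qed
  have outside: "r \<le> R" if "0 \<le> r" "a < \<phi> r" for r
    using that bdd by (auto simp: R_def intro!: cSup_upper)
  have "0 \<le> R"
    using bdd by (auto simp: R_def intro: cSup_upper2)
  have "AE w in lborel. w \<notin> sphere (0::'a) R"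
    using negligible_sphere[of "0::'a" R] by (intro AE_not_in) (auto simp: negligible_iff_null_sets null_sets_completion_iff)
  then have AE: "AE w in lborel. of_bool (a < \<phi> (norm (w::'a))) = (indicator (ball 0 R) w :: ennreal)"
  proof eventually_elim
    case (elim w)
    then show ?case
      using inside[of "norm w"] outside[of "norm w"] by (auto simp: indicator_def)
  qed
  have level: "(\<integral>\<^sup>+w. F w * of_bool (a < \<phi> (norm w)) \<partial>lborel) =
      ennreal (R ^ DIM('a)) * (\<integral>\<^sup>+w. F w * indicator (ball 0 1) w \<partial>lborel)"
    if F: "F \<in> borel_measurable borel" "\<And>t z. 0 < t \<Longrightarrow> F (t *\<^sub>R z) = F z" for F :: "'a \<Rightarrow> ennreal"
  proof -
    have "(\<integral>\<^sup>+w. F w * of_bool (a < \<phi> (norm w)) \<partial>lborel) = (\<integral>\<^sup>+w. F w * indicator (ball 0 R) w \<partial>lborel)"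
      by (intro nn_integral_cong_AE) (use AE in eventually_elim, auto)
    also have "\<dots> = ennreal (R ^ DIM('a)) * (\<integral>\<^sup>+w. F w * indicator (ball 0 1) w \<partial>lborel)"
      using \<open>0 \<le> R\<close> F by (cases "R = 0") (auto intro!: nn_integral_homogeneous_ball simp: power_0_left)
    finally show ?thesis .
  qed
  show ?thesis
    using level[OF G hom] level[of "\<lambda>_. 1"] by (simp add: mult_ac)
qed

lemma nn_integral_layers: "(\<integral>\<^sup>+a. of_bool (0 < a \<and> a < c) \<partial>lborel) = ennreal c" if "0 \<le> c" for c :: real
proof -
  have "(\<integral>\<^sup>+a. of_bool (0 < a \<and> a < c) \<partial>lborel) = (\<integral>\<^sup>+a. indicator {0<..<c} a \<partial>lborel)"
    by (intro nn_integral_cong) (auto simp: indicator_def)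
  then show ?thesis using that by simp
qed

text \<open>
  A substitute for polar coordinates: layer cake in the radial factor reduces the claim to level sets.
\<close>
lemma nn_integral_homogeneous_radial:
  fixes G :: "'a::euclidean_space \<Rightarrow> ennreal" and \<phi> :: "real \<Rightarrow> real"
  assumes G [measurable]: "G \<in> borel_measurable borel" and hom: "\<And>t z. 0 < t \<Longrightarrow> G (t *\<^sub>R z) = G z"
    and \<phi>: "antimono \<phi>" and \<phi>0: "\<And>r. 0 \<le> \<phi> r"
    and fin: "(\<integral>\<^sup>+w. ennreal (\<phi> (norm (w::'a))) \<partial>lborel) < \<infinity>"
  shows "emeasure lborel (ball (0::'a) 1) * (\<integral>\<^sup>+w. G w * ennreal (\<phi> (norm w)) \<partial>lborel) =
    (\<integral>\<^sup>+w. G w * indicator (ball 0 1) w \<partial>lborel) * (\<integral>\<^sup>+w. ennreal (\<phi> (norm (w::'a))) \<partial>lborel)"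
proof -
  have [measurable]: "\<phi> \<in> borel_measurable borel"
  proof -
    have "(\<lambda>r. - \<phi> r) \<in> borel_measurable borel"
      using \<phi> by (intro borel_measurable_mono) (auto simp: monotone_def)
    then show ?thesis by (simp add: borel_measurable_uminus_eq)
  qed
  have layers: "(\<integral>\<^sup>+w. F w * ennreal (\<phi> (norm w)) \<partial>lborel) =
      (\<integral>\<^sup>+a. of_bool (0 < a) * (\<integral>\<^sup>+w. F w * of_bool (a < \<phi> (norm w)) \<partial>lborel) \<partial>lborel)"
    if [measurable]: "F \<in> borel_measurable borel" for F :: "'a \<Rightarrow> ennreal"
  proof -
    have "(\<integral>\<^sup>+w. F w * ennreal (\<phi> (norm w)) \<partial>lborel) =
        (\<integral>\<^sup>+w. \<integral>\<^sup>+a. F w * of_bool (0 < a \<and> a < \<phi> (norm w)) \<partial>lborel \<partial>lborel)"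
      using \<phi>0 by (simp add: nn_integral_cmult nn_integral_layers)
    also have "\<dots> = (\<integral>\<^sup>+a. \<integral>\<^sup>+w. F w * of_bool (0 < a \<and> a < \<phi> (norm w)) \<partial>lborel \<partial>lborel)"
      by (intro lborel_pair.Fubini'[symmetric]) measurable
    also have "\<dots> = (\<integral>\<^sup>+a. of_bool (0 < a) * (\<integral>\<^sup>+w. F w * of_bool (a < \<phi> (norm w)) \<partial>lborel) \<partial>lborel)"
      by (simp add: nn_integral_cmult[symmetric] of_bool_conj mult_ac)
    finally show ?thesis .
  qed
  have "emeasure lborel (ball (0::'a) 1) * (of_bool (0 < a) * (\<integral>\<^sup>+w. G w * of_bool (a < \<phi> (norm w)) \<partial>lborel)) =
      (\<integral>\<^sup>+w. G w * indicator (ball 0 1) w \<partial>lborel) * (of_bool (0 < a) * (\<integral>\<^sup>+w. 1 * of_bool (a < \<phi> (norm (w::'a))) \<partial>lborel))" for a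
  proof (cases "0 < a")
    case True
    have "ennreal a * (\<integral>\<^sup>+w. of_bool (a < \<phi> (norm (w::'a))) \<partial>lborel) \<le> (\<integral>\<^sup>+w. ennreal (\<phi> (norm (w::'a))) \<partial>lborel)"
      by (subst nn_integral_cmult[symmetric]) (auto intro!: nn_integral_mono simp: of_bool_def ennreal_leI)
    then have "ennreal a * (\<integral>\<^sup>+w. of_bool (a < \<phi> (norm (w::'a))) \<partial>lborel) < \<infinity>"
      using fin by (rule order.strict_trans1)
    then have "(\<integral>\<^sup>+w. of_bool (a < \<phi> (norm (w::'a))) \<partial>lborel) < \<infinity>"
      using True by (auto simp: ennreal_mult_less_top)
    then show ?thesis
      using True nn_integral_homogeneous_level_set[OF G hom \<phi>, of a] by simp
  qed simp
  note level = this
  let ?J = "\<integral>\<^sup>+w. G w * indicator (ball 0 1) w \<partial>lborel"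
  have "emeasure lborel (ball (0::'a) 1) * (\<integral>\<^sup>+w. G w * ennreal (\<phi> (norm w)) \<partial>lborel) =
      (\<integral>\<^sup>+a. emeasure lborel (ball (0::'a) 1) *
        (of_bool (0 < a) * (\<integral>\<^sup>+w. G w * of_bool (a < \<phi> (norm w)) \<partial>lborel)) \<partial>lborel)"
    unfolding layers[OF G] by (intro nn_integral_cmult[symmetric]) measurable
  also have "\<dots> = (\<integral>\<^sup>+a. ?J * (of_bool (0 < a) * (\<integral>\<^sup>+w. 1 * of_bool (a < \<phi> (norm (w::'a))) \<partial>lborel)) \<partial>lborel)"
    by (simp only: level)
  also have "\<dots> = ?J * (\<integral>\<^sup>+w. 1 * ennreal (\<phi> (norm (w::'a))) \<partial>lborel)"
    unfolding layers[OF borel_measurable_const] by (intro nn_integral_cmult) measurable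
  finally show ?thesis by simp
qed

lemma sets_surface_measure: "sets surface_measure = sets (restrict_space borel (sphere 0 1))"
  by (simp add: surface_measure_def)

text \<open>
  The cone construction of the surface measure, with the origin put back into the ball.
\<close>
lemma nn_integral_surface_measure:
  fixes F :: "'a::euclidean_space \<Rightarrow> ennreal"
  assumes F [measurable]: "F \<in> borel_measurable borel"
  shows "(\<integral>\<^sup>+\<xi>. F \<xi> \<partial>surface_measure) =
    of_nat DIM('a) * (\<integral>\<^sup>+w. F (w /\<^sub>R norm w) * indicator (ball 0 1) w \<partial>lborel)"
proof -
  let ?B = "ball 0 1 - {0 :: 'a}"
  let ?\<pi> = "\<lambda>x::'a. x /\<^sub>R norm x"
  have B: "?B \<in> sets borel" by auto
  have \<pi>: "?\<pi> \<in> restrict_space lborel ?B \<rightarrow>\<^sub>M restrict_space borel (sphere 0 1)"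
    by (intro measurable_restrict_space2 measurable_restrict_space1) (auto simp: space_restrict_space)
  have F': "F \<in> borel_measurable (restrict_space borel (sphere 0 1))"
    by (rule measurable_restrict_space1[OF F])
  have "(\<integral>\<^sup>+\<xi>. F \<xi> \<partial>surface_measure) =
      of_nat DIM('a) * (\<integral>\<^sup>+w. F (?\<pi> w) \<partial>restrict_space lborel ?B)"
    unfolding surface_measure_def using F' \<pi>
    by (simp add: nn_integral_scale_measure nn_integral_distr)
  also have "(\<integral>\<^sup>+w. F (?\<pi> w) \<partial>restrict_space lborel ?B) = (\<integral>\<^sup>+w. F (?\<pi> w) * indicator ?B w \<partial>lborel)"
    using B by (intro nn_integral_restrict_space) auto
  also have "\<dots> = (\<integral>\<^sup>+w. F (?\<pi> w) * indicator (ball 0 1) w \<partial>lborel)"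
    by (intro nn_integral_cong_AE) (use AE_lborel_singleton[of 0] in eventually_elim, auto simp: indicator_def)
  finally show ?thesis .
qed

lemma direction_scaleR: "0 < t \<Longrightarrow> (t *\<^sub>R z) /\<^sub>R norm (t *\<^sub>R z) = z /\<^sub>R norm (z :: 'a::euclidean_space)"
  by simp

text \<open>
  The cone over a null set of the sphere is null in the unit ball by the definition of the surface
  measure, hence in every ball by homogeneity.
\<close>
lemma AE_direction:
  fixes P :: "'a::euclidean_space \<Rightarrow> bool"
  assumes P: "AE \<xi> in surface_measure. P \<xi>"
  shows "AE w in lborel. w \<noteq> 0 \<longrightarrow> P (w /\<^sub>R norm w)"
proof -
  obtain N where N: "{\<xi> \<in> space surface_measure. \<not> P \<xi>} \<subseteq> N" "emeasure surface_measure N = 0" "N \<in> sets surface_measure"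
    using AE_E[OF P] by blast
  have [measurable]: "N \<in> sets borel"
    using N(3) unfolding sets_surface_measure by (auto simp: sets_restrict_space)
  define G :: "'a \<Rightarrow> ennreal" where "G w = indicator N (w /\<^sub>R norm w)" for w
  have G [measurable]: "G \<in> borel_measurable borel"
    unfolding G_def by measurable
  have hom: "G (t *\<^sub>R z) = G z" if "0 < t" for t z
    using direction_scaleR[OF that, of z] by (simp only: G_def)
  have "of_nat DIM('a) * (\<integral>\<^sup>+w. G w * indicator (ball 0 1) w \<partial>lborel) = (\<integral>\<^sup>+\<xi>. indicator N \<xi> \<partial>surface_measure)"
    unfolding G_def by (subst nn_integral_surface_measure) auto
  also have "\<dots> = 0"
    using N by simp
  finally have zero: "(\<integral>\<^sup>+w. G w * indicator (ball 0 1) w \<partial>lborel) = 0"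
    by simp
  have "AE w in lborel. G w * indicator (ball 0 (real (Suc k))) w = 0" for k
  proof -
    have meas: "(\<lambda>w. G w * indicator (ball 0 r) w) \<in> borel_measurable lborel" for r
      by (intro borel_measurable_times_ennreal borel_measurable_indicator) auto
    have "(\<integral>\<^sup>+w. G w * indicator (ball 0 (real (Suc k))) w \<partial>lborel) = 0"
      using zero by (subst nn_integral_homogeneous_ball[OF G hom]) auto
    then show ?thesis
      by (subst (asm) nn_integral_0_iff_AE[OF meas])
  qed
  then have "AE w in lborel. \<forall>k. G w * indicator (ball 0 (real (Suc k))) w = 0"
    unfolding AE_all_countable by blast
  then show ?thesis
  proof eventually_elim
    case (elim w)
    obtain k where "norm w < real k"
      using reals_Archimedean2 by blast
    then have "norm w < real (Suc k)" by simp
    with elim[rule_format, of k] have "w /\<^sub>R norm w \<notin> N"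
      by (auto simp: G_def indicator_def split: if_splits)
    moreover have "w /\<^sub>R norm w \<in> space surface_measure" if "w \<noteq> 0"
      using that by simp
    ultimately show ?case
      using N(1) by blast
  qed
qed

lemma nn_integral_radial_direction:
  fixes F :: "'a::euclidean_space \<Rightarrow> ennreal" and \<phi> :: "real \<Rightarrow> real"
  assumes F [measurable]: "F \<in> borel_measurable borel"
    and \<phi>: "antimono \<phi>" and \<phi>0: "\<And>r. 0 \<le> \<phi> r"
    and fin: "(\<integral>\<^sup>+w. ennreal (\<phi> (norm (w::'a))) \<partial>lborel) < \<infinity>"
  shows "of_nat DIM('a) * emeasure lborel (ball (0::'a) 1) *
      (\<integral>\<^sup>+w. F (w /\<^sub>R norm w) * ennreal (\<phi> (norm w)) \<partial>lborel) =
    (\<integral>\<^sup>+\<xi>. F \<xi> \<partial>surface_measure) * (\<integral>\<^sup>+w. ennreal (\<phi> (norm (w::'a))) \<partial>lborel)"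
proof -
  have "emeasure lborel (ball (0::'a) 1) * (\<integral>\<^sup>+w. F (w /\<^sub>R norm w) * ennreal (\<phi> (norm w)) \<partial>lborel) =
    (\<integral>\<^sup>+w. F (w /\<^sub>R norm w) * indicator (ball 0 1) w \<partial>lborel) * (\<integral>\<^sup>+w. ennreal (\<phi> (norm (w::'a))) \<partial>lborel)"
  proof (rule nn_integral_homogeneous_radial[OF _ _ \<phi> \<phi>0 fin])
    show "F ((t *\<^sub>R z) /\<^sub>R norm (t *\<^sub>R z)) = F (z /\<^sub>R norm z)" if "0 < t" for t and z :: 'a
      by (simp only: direction_scaleR[OF that])
  qed measurable
  then show ?thesis
    by (simp add: nn_integral_surface_measure mult.assoc)
qed

lemma nn_integral_radial_eq_integral:
  fixes \<phi> :: "real \<Rightarrow> real"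
  assumes "\<forall>s\<ge>0. 0 \<le> \<phi> s" "integrable lebesgue (\<lambda>x::'a::euclidean_space. \<phi> (norm x))"
  shows "(\<integral>\<^sup>+x. ennreal (\<phi> (norm (x::'a))) \<partial>lborel) = ennreal (\<integral>x. \<bar>\<phi> (norm (x::'a))\<bar> \<partial>lebesgue)"
proof -
  have "(\<integral>\<^sup>+x. ennreal (\<phi> (norm (x::'a))) \<partial>lborel) = (\<integral>\<^sup>+x. ennreal (\<phi> (norm (x::'a))) \<partial>lebesgue)"
    by (simp add: nn_integral_completion)
  also have "\<dots> = ennreal (\<integral>x. \<phi> (norm (x::'a)) \<partial>lebesgue)"
    using assms by (intro nn_integral_eq_integral) auto
  also have "(\<integral>x. \<phi> (norm (x::'a)) \<partial>lebesgue) = (\<integral>x. \<bar>\<phi> (norm (x::'a))\<bar> \<partial>lebesgue)"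
    using assms by (intro Bochner_Integration.integral_cong) auto
  finally show ?thesis .
qed

text \<open>
  Extending by \<open>0\<close> off the sphere makes the representative Borel on the whole space, so that it can be
  composed with the direction map \<open>w \<mapsto> w/|w|\<close> (which sends the origin to itself).
\<close>
lemma borel_representative_on_sphere:
  fixes \<Omega> :: "'a::euclidean_space \<Rightarrow> real"
  assumes "\<Omega> \<in> borel_measurable (completion surface_measure)"
  obtains \<Theta> where "\<Theta> \<in> borel_measurable borel" "AE \<xi> in surface_measure. \<Omega> \<xi> = \<Theta> \<xi>"
proof -
  obtain \<Omega>' where \<Omega>': "\<Omega>' \<in> borel_measurable surface_measure" "AE \<xi> in surface_measure. \<Omega> \<xi> = \<Omega>' \<xi>"
    using completion_ex_borel_measurable_real[OF assms] by blast
  show ?thesis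
  proof
    have "\<Omega>' \<in> borel_measurable (restrict_space borel (sphere 0 1))"
      using \<Omega>'(1) unfolding measurable_cong_sets[OF sets_surface_measure refl] .
    then show "(\<lambda>\<xi>. indicator (sphere 0 1) \<xi> *\<^sub>R \<Omega>' \<xi>) \<in> borel_measurable borel"
      by (subst (asm) borel_measurable_restrict_space_iff) auto
    show "AE \<xi> in surface_measure. \<Omega> \<xi> = indicator (sphere 0 1) \<xi> *\<^sub>R \<Omega>' \<xi>"
      using \<Omega>'(2) AE_space by eventually_elim simp
  qed
qed

lemma nn_integral_LlogL_kernel:
  fixes \<Theta> :: "'a::euclidean_space \<Rightarrow> real" and \<phi> :: "real \<Rightarrow> real"
  assumes \<Theta> [measurable]: "\<Theta> \<in> borel_measurable borel"
    and \<phi>0: "\<forall>s\<ge>0. 0 \<le> \<phi> s" and \<phi>: "antimono_on {0..} \<phi>"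
    and int: "integrable lebesgue (\<lambda>x::'a. \<phi> (norm x))"
    and m: "(\<integral>\<^sup>+\<xi>. ennreal (\<bar>\<Theta> \<xi>\<bar> * (1 + log_plus \<bar>\<Theta> \<xi>\<bar>)) \<partial>surface_measure) = ennreal m" "0 \<le> m"
  shows "(\<integral>\<^sup>+w. ennreal (1 + \<bar>\<Theta> (w /\<^sub>R norm w)\<bar> * (1 + log_plus \<bar>\<Theta> (w /\<^sub>R norm w)\<bar>)) * ennreal (\<phi> (norm w)) \<partial>lborel)
    = ennreal (1 + m / (DIM('a) * measure lborel (ball (0::'a) 1))) * ennreal (\<integral>x. \<bar>\<phi> (norm (x::'a))\<bar> \<partial>lebesgue)"
proof -
  define \<psi> where "\<psi> r = \<phi> (max 0 r)" for r
  have \<psi>: "antimono \<psi>" "\<And>r. 0 \<le> \<psi> r"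
    using \<phi> \<phi>0 by (auto simp: \<psi>_def monotone_on_def)
  have \<psi>_norm: "\<phi> (norm w) = \<psi> (norm w)" for w :: 'a
    by (simp add: \<psi>_def)
  have [measurable]: "(\<lambda>r. ennreal (\<psi> r)) \<in> borel_measurable borel"
    using \<psi> by (intro borel_measurable_antimono_ennreal) (auto simp: monotone_def intro: ennreal_leI)
  let ?F = "\<lambda>\<xi>. ennreal (\<bar>\<Theta> \<xi>\<bar> * (1 + log_plus \<bar>\<Theta> \<xi>\<bar>))"
  let ?s = "DIM('a) * measure lborel (ball (0::'a) 1)"
  let ?I = "\<integral>\<^sup>+w. ennreal (\<psi> (norm (w::'a))) \<partial>lborel"
  let ?J = "\<integral>\<^sup>+w. ?F (w /\<^sub>R norm w) * ennreal (\<psi> (norm w)) \<partial>lborel"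
  have I: "?I = ennreal (\<integral>x. \<bar>\<phi> (norm (x::'a))\<bar> \<partial>lebesgue)"
    using nn_integral_radial_eq_integral[OF \<phi>0 int] by (simp add: \<psi>_norm)
  have s: "0 < ?s"
    by (simp add: content_ball_pos)
  have "of_nat DIM('a) * emeasure lborel (ball (0::'a) 1) = ennreal ?s"
    using emeasure_lborel_ball_finite[of "0::'a" 1]
    by (subst emeasure_eq_ennreal_measure) (auto simp: ennreal_mult' ennreal_of_nat_eq_real_of_nat)
  then have "ennreal ?s * ?J = ennreal m * ?I"
    using nn_integral_radial_direction[of ?F \<psi>] \<psi> m(1) I by simp
  then have "ennreal (1 / ?s) * (ennreal ?s * ?J) = ennreal (1 / ?s) * (ennreal m * ?I)"
    by simp
  moreover have "ennreal (1 / ?s) * ennreal ?s = 1"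
    using s by (subst ennreal_mult[symmetric]) auto
  moreover have "ennreal (1 / ?s) * ennreal m = ennreal (m / ?s)"
    using s m by (subst ennreal_mult[symmetric]) auto
  ultimately have J: "?J = ennreal (m / ?s) * ?I"
    by (simp only: mult.assoc[symmetric] mult_1)
  have "(\<integral>\<^sup>+w. ennreal (1 + \<bar>\<Theta> (w /\<^sub>R norm w)\<bar> * (1 + log_plus \<bar>\<Theta> (w /\<^sub>R norm w)\<bar>)) * ennreal (\<phi> (norm w)) \<partial>lborel)
      = (\<integral>\<^sup>+w. ennreal (\<psi> (norm w)) + ?F (w /\<^sub>R norm w) * ennreal (\<psi> (norm w)) \<partial>lborel)"
    using log_plus_nonneg by (intro nn_integral_cong) (simp add: \<psi>_norm distrib_right)
  also have "\<dots> = ?I + ?J"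
    by (intro nn_integral_add) measurable
  also have "\<dots> = ennreal (1 + m / ?s) * ?I"
    unfolding J using s m by (simp add: distrib_right)
  finally show ?thesis
    unfolding I .
qed

section \<open>The weak type estimate\<close>

text \<open>
  In both parts the weight is a Borel version \<open>W\<close> of \<open>\<Omega>(w/|w|)\<close>.  It turns the \<open>L log L\<close> norm into a
  factor of the integral of \<open>(1 + W (1 + log^+ W)) \<phi>(|w|)\<close>, because the latter splits into an angular
  and a radial integral.
\<close>
theorem theorem3p1:
  fixes \<gamma> :: real
  assumes "\<gamma> > 0"
  shows
    "(CARD('n::finite) \<ge> 2 \<longrightarrow>
       (\<forall>M. \<exists>C>0. \<forall>(\<Omega> :: real^'n \<Rightarrow> real) (\<phi> :: real \<Rightarrow> real) (h :: real^'n \<Rightarrow> real).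
          \<Omega> \<in> LlogL \<and> LlogL_norm \<Omega> = M \<and> (\<forall>\<xi>\<in>sphere 0 1. 0 \<le> \<Omega> \<xi>) \<and>
          (\<forall>s\<ge>0. 0 \<le> \<phi> s) \<and> antimono_on {0..} \<phi> \<and>
          integrable lebesgue (\<lambda>x::real^'n. \<phi> (norm x)) \<and>
          (\<forall>x. x \<noteq> 0 \<longrightarrow> h x = \<Omega> (x /\<^sub>R norm x) * \<phi> (norm x)) \<longrightarrow>
          (\<forall>f :: real^'n \<Rightarrow> complex. integrable lebesgue f \<longrightarrow>
            (SUP l\<in>{0<..}. ennreal l *
               emeasure (nu \<gamma>) {(x, t). 0 < t \<and> norm (T_op \<gamma> h f (x, t)) > l})
            \<le> ennreal (C * (\<integral>x. \<bar>\<phi> (norm (x :: real^'n))\<bar> \<partial>lebesgue) *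
                         (\<integral>x. norm (f x) \<partial>lebesgue)))))
     \<and>
     (\<exists>C>0. \<forall>(\<phi> :: real \<Rightarrow> real) (h :: real \<Rightarrow> real).
          (\<forall>s\<ge>0. 0 \<le> \<phi> s) \<and> antimono_on {0..} \<phi> \<and>
          integrable lebesgue (\<lambda>x::real. \<phi> \<bar>x\<bar>) \<and>
          (\<forall>x. x \<noteq> 0 \<longrightarrow> h x = \<phi> \<bar>x\<bar>) \<longrightarrow>
          (\<forall>f :: real \<Rightarrow> complex. integrable lebesgue f \<longrightarrow>
            (SUP l\<in>{0<..}. ennreal l *
               emeasure (nu \<gamma>) {(x, t). 0 < t \<and> norm (T_op \<gamma> h f (x, t)) > l})
            \<le> ennreal (C * (\<integral>x. \<bar>\<phi> \<bar>x\<bar>\<bar> \<partial>lebesgue) * (\<integral>x. norm (f x) \<partial>lebesgue))))"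
proof (intro conjI impI allI)
  fix M :: ennreal
  define C where "C = weak_type_const TYPE(real^'n) \<gamma>"
  have C: "0 < C"
    unfolding C_def by (rule weak_type_const_pos[OF assms])
  define c where "c = 1 + enn2real M / (DIM(real^'n) * measure lborel (ball (0::real^'n) 1))"
  have c: "1 \<le> c" by (simp add: c_def)
  show "\<exists>C>0. \<forall>(\<Omega> :: real^'n \<Rightarrow> real) (\<phi> :: real \<Rightarrow> real) (h :: real^'n \<Rightarrow> real).
          \<Omega> \<in> LlogL \<and> LlogL_norm \<Omega> = M \<and> (\<forall>\<xi>\<in>sphere 0 1. 0 \<le> \<Omega> \<xi>) \<and>
          (\<forall>s\<ge>0. 0 \<le> \<phi> s) \<and> antimono_on {0..} \<phi> \<and>
          integrable lebesgue (\<lambda>x::real^'n. \<phi> (norm x)) \<and>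
          (\<forall>x. x \<noteq> 0 \<longrightarrow> h x = \<Omega> (x /\<^sub>R norm x) * \<phi> (norm x)) \<longrightarrow>
          (\<forall>f :: real^'n \<Rightarrow> complex. integrable lebesgue f \<longrightarrow>
            (SUP l\<in>{0<..}. ennreal l *
               emeasure (nu \<gamma>) {(x, t). 0 < t \<and> norm (T_op \<gamma> h f (x, t)) > l})
            \<le> ennreal (C * (\<integral>x. \<bar>\<phi> (norm (x :: real^'n))\<bar> \<partial>lebesgue) *
                         (\<integral>x. norm (f x) \<partial>lebesgue)))"
  proof (intro exI[of _ "C * c"] conjI allI impI; (elim conjE)?)
    show "0 < C * c" using C c by simp
  next
    fix \<Omega> :: "real^'n \<Rightarrow> real" and \<phi> :: "real \<Rightarrow> real" and h :: "real^'n \<Rightarrow> real" and f :: "real^'n \<Rightarrow> complex"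
    assume \<Omega>: "\<Omega> \<in> LlogL" and norm_\<Omega>: "LlogL_norm \<Omega> = M" and \<Omega>0: "\<forall>\<xi>\<in>sphere 0 1. 0 \<le> \<Omega> \<xi>"
      and \<phi>0: "\<forall>s\<ge>0. 0 \<le> \<phi> s" and \<phi>: "antimono_on {0..} \<phi>"
      and int: "integrable lebesgue (\<lambda>x::real^'n. \<phi> (norm x))"
      and h: "\<forall>x. x \<noteq> 0 \<longrightarrow> h x = \<Omega> (x /\<^sub>R norm x) * \<phi> (norm x)"
      and f: "integrable lebesgue f"
    obtain \<Theta> where \<Theta> [measurable]: "\<Theta> \<in> borel_measurable borel" and eq: "AE \<xi> in surface_measure. \<Omega> \<xi> = \<Theta> \<xi>"
      using \<Omega> borel_representative_on_sphere[of \<Omega>] by (auto simp: LlogL_def)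
    have "M < \<infinity>"
      using \<Omega> norm_\<Omega> by (simp add: LlogL_def)
    then have M: "M = ennreal (enn2real M)" by simp
    have "(\<integral>\<^sup>+\<xi>. ennreal (\<bar>\<Theta> \<xi>\<bar> * (1 + log_plus \<bar>\<Theta> \<xi>\<bar>)) \<partial>surface_measure) = LlogL_norm \<Omega>"
      unfolding LlogL_norm_def nn_integral_completion
      by (intro nn_integral_cong_AE) (use eq in eventually_elim, simp)
    then have m: "(\<integral>\<^sup>+\<xi>. ennreal (\<bar>\<Theta> \<xi>\<bar> * (1 + log_plus \<bar>\<Theta> \<xi>\<bar>)) \<partial>surface_measure) = ennreal (enn2real M)"
      using norm_\<Omega> M by simp
    define W where "W w = \<bar>\<Theta> (w /\<^sub>R norm w)\<bar>" for w
    have "AE w in lborel. h w = W w * \<phi> (norm w)"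
      using AE_direction[OF eq] AE_lborel_singleton[of 0]
    proof eventually_elim
      case (elim w)
      then have "w /\<^sub>R norm w \<in> sphere 0 1" by simp
      then have "0 \<le> \<Omega> (w /\<^sub>R norm w)" using \<Omega>0 by blast
      with elim h show ?case by (simp add: W_def)
    qed
    moreover have "W \<in> borel_measurable borel"
      unfolding W_def by measurable
    moreover have "W (t *\<^sub>R z) = W z" if "0 < t" for t z
      unfolding W_def by (simp only: direction_scaleR[OF that])
    ultimately have "(SUP l\<in>{0<..}. ennreal l * emeasure (nu \<gamma>) {(x, t). 0 < t \<and> norm (T_op \<gamma> h f (x, t)) > l})
      \<le> ennreal C * (ennreal (\<integral>x. norm (f x) \<partial>lebesgue) *
          (\<integral>\<^sup>+w. ennreal (1 + W w * (1 + log_plus (W w))) * ennreal (\<phi> (norm w)) \<partial>lborel))"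
      unfolding C_def using assms \<phi>0 \<phi> f by (intro T_op_weak_type) (auto simp: W_def)
    also have "(\<integral>\<^sup>+w. ennreal (1 + W w * (1 + log_plus (W w))) * ennreal (\<phi> (norm w)) \<partial>lborel)
        = ennreal c * ennreal (\<integral>x. \<bar>\<phi> (norm (x :: real^'n))\<bar> \<partial>lebesgue)"
      unfolding W_def c_def using \<phi>0 \<phi> int m by (intro nn_integral_LlogL_kernel) auto
    also have "ennreal C * (ennreal (\<integral>x. norm (f x) \<partial>lebesgue) *
        (ennreal c * ennreal (\<integral>x. \<bar>\<phi> (norm (x :: real^'n))\<bar> \<partial>lebesgue))) =
        ennreal (C * c * (\<integral>x. \<bar>\<phi> (norm (x :: real^'n))\<bar> \<partial>lebesgue) * (\<integral>x. norm (f x) \<partial>lebesgue))"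
      using C c by (simp add: ennreal_mult' mult_ac)
    finally show "(SUP l\<in>{0<..}. ennreal l * emeasure (nu \<gamma>) {(x, t). 0 < t \<and> norm (T_op \<gamma> h f (x, t)) > l})
      \<le> ennreal (C * c * (\<integral>x. \<bar>\<phi> (norm (x :: real^'n))\<bar> \<partial>lebesgue) * (\<integral>x. norm (f x) \<partial>lebesgue))" .
  qed
next
  define C where "C = weak_type_const TYPE(real) \<gamma>"
  have C: "0 < C"
    unfolding C_def by (rule weak_type_const_pos[OF assms])
  show "\<exists>C>0. \<forall>(\<phi> :: real \<Rightarrow> real) (h :: real \<Rightarrow> real).
          (\<forall>s\<ge>0. 0 \<le> \<phi> s) \<and> antimono_on {0..} \<phi> \<and>
          integrable lebesgue (\<lambda>x::real. \<phi> \<bar>x\<bar>) \<and>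
          (\<forall>x. x \<noteq> 0 \<longrightarrow> h x = \<phi> \<bar>x\<bar>) \<longrightarrow>
          (\<forall>f :: real \<Rightarrow> complex. integrable lebesgue f \<longrightarrow>
            (SUP l\<in>{0<..}. ennreal l *
               emeasure (nu \<gamma>) {(x, t). 0 < t \<and> norm (T_op \<gamma> h f (x, t)) > l})
            \<le> ennreal (C * (\<integral>x. \<bar>\<phi> \<bar>x\<bar>\<bar> \<partial>lebesgue) * (\<integral>x. norm (f x) \<partial>lebesgue)))"
  proof (intro exI[of _ "C * 2"] conjI allI impI; (elim conjE)?)
    show "0 < C * 2" using C by simp
  next
    fix \<phi> h :: "real \<Rightarrow> real" and f :: "real \<Rightarrow> complex"
    assume \<phi>0: "\<forall>s\<ge>0. 0 \<le> \<phi> s" and \<phi>: "antimono_on {0..} \<phi>"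
      and int: "integrable lebesgue (\<lambda>x::real. \<phi> \<bar>x\<bar>)"
      and h: "\<forall>x. x \<noteq> 0 \<longrightarrow> h x = \<phi> \<bar>x\<bar>"
      and f: "integrable lebesgue f"
    define \<psi> where "\<psi> r = ennreal (\<phi> (max 0 r))" for r
    have \<psi>: "antimono \<psi>"
      using \<phi> by (auto simp: \<psi>_def monotone_on_def intro!: ennreal_leI)
    note [measurable] = borel_measurable_antimono_ennreal[OF \<psi>]
    \<comment> \<open>The constant weight \<open>1\<close>, whose \<open>L log L\<close> density \<open>1 + 1 * (1 + log_plus 1)\<close> is \<open>2\<close>.\<close>
    have "AE w in lborel. h w = 1 * \<phi> (norm w)"
      using AE_lborel_singleton[of 0] by eventually_elim (use h in simp)
    then have "(SUP l\<in>{0<..}. ennreal l * emeasure (nu \<gamma>) {(x, t). 0 < t \<and> norm (T_op \<gamma> h f (x, t)) > l})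
      \<le> ennreal C * (ennreal (\<integral>x. norm (f x) \<partial>lebesgue) *
          (\<integral>\<^sup>+w. ennreal (1 + 1 * (1 + log_plus 1)) * ennreal (\<phi> (norm (w::real))) \<partial>lborel))"
      unfolding C_def using assms \<phi>0 \<phi> f by (intro T_op_weak_type[where W = "\<lambda>_. 1"]) auto
    also have "(\<integral>\<^sup>+w. ennreal (1 + 1 * (1 + log_plus 1)) * ennreal (\<phi> (norm (w::real))) \<partial>lborel) = (\<integral>\<^sup>+w. 2 * \<psi> (norm (w::real)) \<partial>lborel)"
      by (intro nn_integral_cong) (simp add: log_plus_def \<psi>_def)
    also have "\<dots> = 2 * (\<integral>\<^sup>+w. \<psi> (norm (w::real)) \<partial>lborel)"
      by (intro nn_integral_cmult) measurable
    also have "(\<integral>\<^sup>+w. \<psi> (norm (w::real)) \<partial>lborel) = ennreal (\<integral>x. \<bar>\<phi> \<bar>x\<bar>\<bar> \<partial>lebesgue)"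
      using nn_integral_radial_eq_integral[where 'a=real, OF \<phi>0] int by (simp add: \<psi>_def)
    also have "ennreal C * (ennreal (\<integral>x. norm (f x) \<partial>lebesgue) * (2 * ennreal (\<integral>x. \<bar>\<phi> \<bar>x\<bar>\<bar> \<partial>lebesgue))) =
        ennreal (C * 2 * (\<integral>x. \<bar>\<phi> \<bar>x\<bar>\<bar> \<partial>lebesgue) * (\<integral>x. norm (f x) \<partial>lebesgue))"
      using C by (simp add: ennreal_mult' mult_ac)
    finally show "(SUP l\<in>{0<..}. ennreal l * emeasure (nu \<gamma>) {(x, t). 0 < t \<and> norm (T_op \<gamma> h f (x, t)) > l})
      \<le> ennreal (C * 2 * (\<integral>x. \<bar>\<phi> \<bar>x\<bar>\<bar> \<partial>lebesgue) * (\<integral>x. norm (f x) \<partial>lebesgue))" .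
  qed
qed

end
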